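(* Let $n\ge 1$, let $0\le N_b\le N_h$ be integers with $N_b+N_h\le n$, let $p\in[0,1]$, and set $N_l=N_h-N_b$. Consider the golf process on $\mathbb{Z}/n\mathbb{Z}$ under $\mathbb{P}^{n,N_b,N_h,p}$ (described in the context), and let $H^1$ be its set of free holes at time $1$. For every $X\subseteq \mathbb{Z}/n\mathbb{Z}$ with $|X|=N_l>0$, writing $\ell_i=\Delta_i X$ for $i\in\mathbb{Z}/N_l\mathbb{Z}$, $$\mathbb{P}^{n,N_b,N_h,p}\left(H^1=X\right)=\frac{1}{\binom{n}{N_b,\,N_h,\,n-N_b-N_h}}\sum_{(b_i)\in B^{(N_b,X)}}\ \prod_{i\in\mathbb{Z}/N_l\mathbb{Z}}\frac{1}{b_i+1}\binom{\ell_i}{b_i,\,b_i,\,\ell_i-2b_i},$$ where $B^{(N_b,X)}=\{(b_i)_{i\in\mathbb{Z}/N_l\mathbb{Z}}\in\mathbb{Z}_{\ge0}^{N_l}:\ \sum_i b_i=N_b,\ 0\le b_i\le \ell_i/2\ \forall i\}$. In particular this distribution does not depend on $p$.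
   Context: Golf process on the cycle $\mathbb{Z}/n\mathbb{Z}$ (edges $\{x,x+1\}$): the initial configuration is chosen uniformly among all assignments of states to the vertices in which exactly $N_b$ vertices contain a ball, exactly $N_h$ vertices are holes, and the remaining vertices are neutral. Each vertex $v$ has a clock $C(v)$, the clocks being i.i.d. uniform on $[0,1]$ and independent of the configuration. At time $C(v)$, if $v$ contains a ball, this ball performs a random walk on $\mathbb{Z}/n\mathbb{Z}$ (step $x\to x+1$ with probability $p$, $x\to x-1$ with probability $1-p$, independent of everything else) started at $v$ and stopped at the first time it is at a hole that has not yet been filled; it fills this hole, and both $v$ and that hole become neutral. $H^1$ is the set of holes never filled (it has $N_h-N_b$ elements). $\mathbb{P}^{n,N_b,N_h,p}$ denotes the law of this process. Block notation: let $\pi:\mathbb{Z}/n\mathbb{Z}\to\{1,\dots,n\}$ be the canonical bijection. A set $X$ with $|X|=k$ is identified with the unique sequence $(x_i)_{i\in\mathbb{Z}/k\mathbb{Z}}$ of its elements with $\pi(x_1)<\dots<\pi(x_k)=\pi(x_0)$, and $\Delta_i X=\pi(x_{i+1})-\pi(x_i)-1 \bmod n$ is the size of the $i$-th block (the set of vertices strictly between $x_i$ and $x_{i+1}$ going around the cycle in increasing direction). *)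

theory Defs
  imports "HOL-Probability.Probability"
begin

text \<open>Vertices of the cycle Z/nZ are represented by 0..n-1 (canonical bijection pi(x) = x+1,
so the order used for block notation is the usual order of 0..n-1).\<close>

definition walk_pos :: "nat \<Rightarrow> nat \<Rightarrow> bool list \<Rightarrow> nat \<Rightarrow> nat" where
  "walk_pos n v s j = nat ((int v + (\<Sum>i<j. if s ! i then 1 else -1)) mod int n)"

definition path_prob :: "real \<Rightarrow> bool list \<Rightarrow> real" where
  "path_prob p s = (\<Prod>i<length s. if s ! i then p else 1 - p)"

text \<open>Probability that the walk started at v, stopped at the first time it is in the
set H of (unfilled) holes, is stopped at hole h: sum over the hitting time k and over
all step sequences of length k that first hit H at time k, in h.\<close>
definition hit_prob :: "real \<Rightarrow> nat \<Rightarrow> nat \<Rightarrow> nat set \<Rightarrow> nat \<Rightarrow> real" where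
  "hit_prob p n v H h =
     (\<Sum>k. \<Sum>s\<in>{s::bool list. length s = k}.
        (if (\<forall>j<k. walk_pos n v s j \<notin> H) \<and> walk_pos n v s k = h
         then path_prob p s else 0))"

text \<open>Given the list of balls in the order they are activated and the current set of
unfilled holes H, probability that the final set of unfilled holes is X.\<close>
fun golf_run :: "real \<Rightarrow> nat \<Rightarrow> nat list \<Rightarrow> nat set \<Rightarrow> nat set \<Rightarrow> real" where
  "golf_run p n [] H X = (if H = X then 1 else 0)"
| "golf_run p n (v # vs) H X = (\<Sum>h\<in>H. hit_prob p n v H h * golf_run p n vs (H - {h}) X)"

definition golf_configs :: "nat \<Rightarrow> nat \<Rightarrow> nat \<Rightarrow> (nat set \<times> nat set) set" where
  "golf_configs n Nb Nh = {(B, H). B \<subseteq> {0..<n} \<and> H \<subseteq> {0..<n} \<and> B \<inter> H = {}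
      \<and> card B = Nb \<and> card H = Nh}"

definition clock_measure :: "nat \<Rightarrow> (nat \<Rightarrow> real) measure" where
  "clock_measure n = PiM {0..<n} (\<lambda>_. uniform_measure lborel {0..1::real})"

definition golf_prob :: "nat \<Rightarrow> nat \<Rightarrow> nat \<Rightarrow> real \<Rightarrow> nat set \<Rightarrow> real" where
  "golf_prob n Nb Nh p X =
     (1 / real (card (golf_configs n Nb Nh))) *
     (\<Sum>(B, H)\<in>golf_configs n Nb Nh.
        (\<integral>C. golf_run p n (sort_key C (sorted_list_of_set B)) H X \<partial>(clock_measure n)))"

text \<open>Block sizes Delta_i X for i = 0..|X|-1 (the paper's index i+1), with x_0 < ... < x_{k-1}
the sorted elements of X.\<close>
definition block_size :: "nat \<Rightarrow> nat set \<Rightarrow> nat \<Rightarrow> nat" where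
  "block_size n X i =
     (let xs = sorted_list_of_set X; k = card X in
      nat ((int (xs ! ((i + 1) mod k)) - int (xs ! i) - 1) mod int n))"

definition B_set :: "nat \<Rightarrow> nat \<Rightarrow> nat set \<Rightarrow> (nat \<Rightarrow> nat) set" where
  "B_set n Nb X = {b. (\<forall>i. i \<ge> card X \<longrightarrow> b i = 0) \<and> (\<Sum>i<card X. b i) = Nb
                      \<and> (\<forall>i<card X. 2 * b i \<le> block_size n X i)}"

end

theory Submission
  imports Defs
begin

text \<open>Conditioning a walk that may no longer stop at \<open>h\<close> on its passage through \<open>h\<close> shows that the law of
  the final set of free holes does not depend on the order in which the balls are played, so the clocks
  disappear. If \<open>X\<close> is the final set of free holes, no ball ever crosses \<open>X\<close>; hence the weight of a
  configuration is the product, over the blocks of \<open>X\<close>, of the probabilities that each block, played alone,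
  keeps its balls inside. A block of size \<open>l\<close> with \<open>b\<close> balls and \<open>b\<close> holes behaves like a cycle of length
  \<open>l + 1\<close> with the additional hole \<open>0\<close>, required to stay free. On that cycle exactly one hole stays free, and
  by rotation invariance it is uniform, so the total weight of a block is the number of configurations
  with \<open>b\<close> balls and \<open>b + 1\<close> holes divided by \<open>l + 1\<close>, whatever \<open>p\<close> is.\<close>

section \<open>First hitting probabilities at a fixed time\<close>

text \<open>This is the inner path sum of \<open>hit_prob\<close>, conditioned on the first step, so
  that induction on time applies. The left neighbour is written \<open>v + n - 1\<close> because
  subtraction of naturals truncates.\<close>

fun first_hit :: "real \<Rightarrow> nat \<Rightarrow> nat set \<Rightarrow> nat \<Rightarrow> nat \<Rightarrow> nat \<Rightarrow> real" where
  "first_hit p n H h 0 v = (if v = h then 1 else 0)"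
| "first_hit p n H h (Suc k) v =
     (if v \<in> H then 0
      else p * first_hit p n H h k ((v + 1) mod n) + (1 - p) * first_hit p n H h k ((v + n - 1) mod n))"

lemma walk_pos_0: "v < n \<Longrightarrow> walk_pos n v s 0 = v"
  by (simp add: walk_pos_def)

lemma walk_pos_Cons_Suc:
  assumes "v < n"
  shows "walk_pos n v (c # s) (Suc j) =
    walk_pos n (if c then (v + 1) mod n else (v + n - 1) mod n) s j"
proof -
  have 1: "int ((v + n - 1) mod n) = (int v - 1) mod int n"
    using assms by (simp add: zmod_int of_nat_diff) (metis diff_add_eq mod_add_self2)
  have 2: "int ((v + 1) mod n) = (int v + 1) mod int n"
    by (simp add: zmod_int add.commute)
  show ?thesis
  proof (cases c)
    case True
    then show ?thesis
      unfolding walk_pos_def sum.lessThan_Suc_shift if_P[OF True] 2 mod_add_left_eq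
      by (simp add: add.assoc)
  next
    case False
    then show ?thesis
      unfolding walk_pos_def sum.lessThan_Suc_shift if_not_P[OF False] 1 mod_add_left_eq
      by (simp add: algebra_simps)
  qed
qed

lemma path_prob_Cons: "path_prob p (c # s) = (if c then p else 1 - p) * path_prob p s"
  unfolding path_prob_def length_Cons prod.lessThan_Suc_shift by simp

lemma sum_lists_Suc:
  fixes f :: "bool list \<Rightarrow> real"
  shows "(\<Sum>s\<in>{s. length s = Suc k}. f s) =
    (\<Sum>s\<in>{s. length s = k}. f (True # s)) + (\<Sum>s\<in>{s. length s = k}. f (False # s))"
proof -
  have fin: "finite {s::bool list. length s = k}"
    using finite_lists_length_eq[of "UNIV::bool set" k] by simp
  have "{s::bool list. length s = Suc k} =
      Cons True ` {s. length s = k} \<union> Cons False ` {s. length s = k}"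
    by (auto simp: length_Suc_conv image_iff)
  then show ?thesis
    using fin by (simp only:) (subst sum.union_disjoint, auto simp: sum.reindex)
qed

lemma sum_paths_eq_first_hit:
  assumes "v < n"
  shows "(\<Sum>s\<in>{s::bool list. length s = k}.
            (if (\<forall>j<k. walk_pos n v s j \<notin> H) \<and> walk_pos n v s k = h then path_prob p s else 0))
         = first_hit p n H h k v"
  using assms
proof (induction k arbitrary: v)
  case 0
  then show ?case by (auto simp: walk_pos_0 path_prob_def)
next
  case (Suc k)
  let ?r = "(v + 1) mod n" and ?l = "(v + n - 1) mod n"
  have lt: "?r < n" "?l < n" using Suc.prems by auto
  \<comment> \<open>The condition at time 0 says that \<open>v\<close> avoids \<open>H\<close>; the
    remaining conditions concern the walk started at the neighbour chosen by the first step.\<close>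
  have *: "(if (\<forall>j<Suc k. walk_pos n v (c # s) j \<notin> H) \<and> walk_pos n v (c # s) (Suc k) = h
             then path_prob p (c # s) else 0) =
      (if v \<in> H then 0 else (if c then p else 1 - p) *
        (let w = (if c then ?r else ?l) in
          if (\<forall>j<k. walk_pos n w s j \<notin> H) \<and> walk_pos n w s k = h then path_prob p s else 0))" for c s
    using Suc.prems by (auto simp: All_less_Suc2 walk_pos_0 walk_pos_Cons_Suc path_prob_Cons Let_def)
  show ?case
    unfolding sum_lists_Suc *
    unfolding Let_def first_hit.simps Suc.IH[OF lt(1), symmetric] Suc.IH[OF lt(2), symmetric]
      sum_distrib_left
    by simp
qed

lemma hit_prob_eq_suminf:
  "v < n \<Longrightarrow> hit_prob p n v H h = (\<Sum>k. first_hit p n H h k v)"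
  by (simp add: hit_prob_def sum_paths_eq_first_hit)

text \<open>Coupling of two walks driven by the same steps; \<open>R\<close> only has to survive until the hitting time.\<close>

lemma first_hit_simulation:
  assumes "R y z"
    and "\<And>y z. R y z \<Longrightarrow> (y = h' \<longleftrightarrow> z = h) \<and> (y \<in> H' \<longleftrightarrow> z \<in> H)"
    and "\<And>y z. R y z \<Longrightarrow> y \<notin> H' \<Longrightarrow>
      R ((y + 1) mod m) ((z + 1) mod n) \<and> R ((y + m - 1) mod m) ((z + n - 1) mod n)"
  shows "first_hit p m H' h' k y = first_hit p n H h k z"
  using assms(1)
proof (induction k arbitrary: y z)
  case 0
  then show ?case using assms(2) by simp
next
  case (Suc k)
  show ?case
  proof (cases "y \<in> H'")
    case True
    then show ?thesis using assms(2) Suc.prems by simp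
  next
    case False
    then have "z \<notin> H" using assms(2) Suc.prems by blast
    then show ?thesis
      using False assms(3)[OF Suc.prems False, THEN conjunct1, THEN Suc.IH]
        assms(3)[OF Suc.prems False, THEN conjunct2, THEN Suc.IH] by simp
  qed
qed

lemma first_hit_nonneg: "0 \<le> p \<Longrightarrow> p \<le> 1 \<Longrightarrow> 0 \<le> first_hit p n H h k v"
  by (induction k arbitrary: v) auto

text \<open>The events of first hitting at distinct times are disjoint. The induction conditions on
  the first step; from a start inside \<open>H\<close> only the term at time 0 can be
  nonzero.\<close>

lemma sum_first_hit_le_1:
  assumes "0 \<le> p" "p \<le> 1" "h \<in> H"
  shows "(\<Sum>i<k. first_hit p n H h i v) \<le> 1"
proof (induction k arbitrary: v)
  case (Suc k)
  show ?case
  proof (cases "v \<in> H")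
    case True
    then show ?thesis by (simp add: sum.lessThan_Suc_shift del: sum.lessThan_Suc)
  next
    case False
    then have "(\<Sum>i<Suc k. first_hit p n H h i v) =
      p * (\<Sum>i<k. first_hit p n H h i ((v + 1) mod n)) +
      (1 - p) * (\<Sum>i<k. first_hit p n H h i ((v + n - 1) mod n))"
      using assms(3)
      by (auto simp: sum.lessThan_Suc_shift sum.distrib sum_distrib_left simp del: sum.lessThan_Suc)
    also have "\<dots> \<le> p * 1 + (1 - p) * 1"
      by (intro add_mono mult_left_mono Suc.IH) (use assms in auto)
    finally show ?thesis by simp
  qed
qed auto

lemma summable_first_hit:
  assumes "0 \<le> p" "p \<le> 1" "h \<in> H"
  shows "summable (\<lambda>k. first_hit p n H h k v)"
  unfolding summable_iff_convergent
  by (intro Bseq_monoseq_convergent BseqI'[where K = 1] incseq_imp_monoseq incseq_SucI)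
     (use sum_first_hit_le_1[OF assms] in \<open>auto simp: first_hit_nonneg[OF assms(1,2)] sum_nonneg\<close>)

text \<open>Strong Markov property: the first hole of \<open>H\<close> that is met is either \<open>h'\<close>, or \<open>h\<close>, from where the walk
  goes on.\<close>

lemma first_hit_remove_hole:
  assumes "h \<in> H" "h' \<in> H" "h \<noteq> h'"
  shows "first_hit p n (H - {h}) h' k w = first_hit p n H h' k w +
    (\<Sum>i\<le>k. first_hit p n H h i w * first_hit p n (H - {h}) h' (k - i) h)"
proof (induction k arbitrary: w)
  case 0
  then show ?case using assms by auto
next
  case (Suc k)
  show ?case
  proof (cases "w \<in> H")
    case True
    then show ?thesis using assms by (simp add: sum.atMost_Suc_shift del: sum.atMost_Suc)
  next
    case False
    define a b where "a = (w + 1) mod n" and "b = (w + n - 1) mod n"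
    have "(\<Sum>i\<le>Suc k. first_hit p n H h i w * first_hit p n (H - {h}) h' (Suc k - i) h) =
        p * (\<Sum>i\<le>k. first_hit p n H h i a * first_hit p n (H - {h}) h' (k - i) h) +
        (1 - p) * (\<Sum>i\<le>k. first_hit p n H h i b * first_hit p n (H - {h}) h' (k - i) h)"
      using False assms(1)
      by (auto simp: sum.atMost_Suc_shift a_def b_def sum.distrib[symmetric] sum_distrib_left
            distrib_right mult.assoc simp del: sum.atMost_Suc)
    then show ?thesis
      using False by (simp add: a_def[symmetric, simplified] b_def[symmetric, simplified]
          Suc.IH[of a] Suc.IH[of b] distrib_left)
  qed
qed

text \<open>Summed over time, the convolution in \<open>first_hit_remove_hole\<close> is a Cauchy
  product of two absolutely convergent series, hence a product of hitting probabilities.\<close>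

lemma hit_prob_remove_hole:
  assumes "0 \<le> p" "p \<le> 1" "h \<in> H" "h' \<in> H" "h \<noteq> h'" "w < n" "h < n"
  shows "hit_prob p n w (H - {h}) h' =
    hit_prob p n w H h' + hit_prob p n w H h * hit_prob p n h (H - {h}) h'"
proof -
  have s: "summable (\<lambda>k. first_hit p n H g k v)" if "g \<in> H" for g H v
    using summable_first_hit assms that by blast
  have s': "summable (\<lambda>k. norm (first_hit p n H g k v))" if "g \<in> H" for g H v
    using s[OF that] first_hit_nonneg[OF assms(1,2)] by simp
  have "(\<lambda>k. first_hit p n H h' k w +
      (\<Sum>i\<le>k. first_hit p n H h i w * first_hit p n (H - {h}) h' (k - i) h)) sums
    ((\<Sum>k. first_hit p n H h' k w) +
     (\<Sum>k. first_hit p n H h k w) * (\<Sum>k. first_hit p n (H - {h}) h' k h))"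
    by (intro sums_add summable_sums s Cauchy_product_sums s') (use assms in auto)
  then show ?thesis
    using assms by (simp add: hit_prob_eq_suminf first_hit_remove_hole[symmetric] sums_iff)
qed

subsection \<open>Order invariance\<close>

lemma golf_run_Cons_Cons:
  "golf_run p n (v # w # vs) H X = (\<Sum>h\<in>H. \<Sum>g\<in>H - {h}.
    hit_prob p n v H h * hit_prob p n w (H - {h}) g * golf_run p n vs (H - {h} - {g}) X)"
  by (simp add: sum_distrib_left mult.assoc)

text \<open>Splitting the second ball's walk at its possible passage through \<open>h\<close> gives
  two sums. The one containing \<open>G\<close> is visibly symmetric in \<open>v\<close> and
  \<open>w\<close>; the other becomes so once \<open>h\<close> and \<open>g\<close> are exchanged,
  since the remaining holes do not depend on their order.\<close>

lemma golf_run_swap: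
  assumes p: "0 \<le> p" "p \<le> 1" and H: "H \<subseteq> {0..<n}" and vw: "v < n" "w < n"
  shows "golf_run p n (v # w # vs) H X = golf_run p n (w # v # vs) H X"
proof -
  have fin: "finite H" using H finite_subset by blast
  define f where "f = (\<lambda>h g. golf_run p n vs (H - {h} - {g}) X)"
  define P where "P = (\<lambda>v h. hit_prob p n v H h)"
  define G where "G = (\<lambda>h g. hit_prob p n h (H - {h}) g)"
  have f: "f h g = f g h" for h g
  proof -
    have "H - {h} - {g} = H - {g} - {h}" by blast
    then show ?thesis by (simp add: f_def)
  qed
  have e: "golf_run p n (v # w # vs) H X =
      (\<Sum>h\<in>H. \<Sum>g\<in>H - {h}. P v h * P w g * f h g) + (\<Sum>h\<in>H. \<Sum>g\<in>H - {h}. P v h * P w h * G h g * f h g)"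
    if "v < n" "w < n" for v w
  proof -
    have "golf_run p n (v # w # vs) H X =
      (\<Sum>h\<in>H. \<Sum>g\<in>H - {h}. P v h * (P w g + P w h * G h g) * f h g)"
      unfolding golf_run_Cons_Cons f_def P_def G_def
      by (intro sum.cong refl, subst hit_prob_remove_hole) (use p H that in auto)
    then show ?thesis by (simp add: sum.distrib algebra_simps)
  qed
  \<comment> \<open>The summation runs over ordered pairs of distinct holes, so the two sums can be
    interchanged.\<close>
  have "(\<Sum>h\<in>H. \<Sum>g\<in>H - {h}. P v h * P w g * f h g) = (\<Sum>g\<in>H. \<Sum>h\<in>H - {g}. P v h * P w g * f h g)"
  proof -
    have "(\<Sum>h\<in>H. \<Sum>g\<in>{g\<in>H. g \<noteq> h}. P v h * P w g * f h g) =
        (\<Sum>g\<in>H. \<Sum>h\<in>{h\<in>H. g \<noteq> h}. P v h * P w g * f h g)"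
      by (rule sum.swap_restrict[OF fin fin])
    moreover have "{g\<in>H. g \<noteq> h} = H - {h}" "{g\<in>H. h \<noteq> g} = H - {h}" for h by auto
    ultimately show ?thesis by simp
  qed
  then show ?thesis
    using e[OF vw] e[OF vw(2,1)] f by (simp add: mult.commute mult.left_commute)
qed

lemma golf_run_move_to_front:
  assumes "0 \<le> p" "p \<le> 1" "H \<subseteq> {0..<n}" "set us \<subseteq> {0..<n}" "v < n"
  shows "golf_run p n (us @ v # vs) H X = golf_run p n (v # us @ vs) H X"
  using assms(3,4)
proof (induction us arbitrary: H)
  case (Cons u us)
  have "golf_run p n ((u # us) @ v # vs) H X = golf_run p n (u # v # us @ vs) H X"
    using Cons.prems unfolding append_Cons golf_run.simps(2)[of p n u]
    by (intro sum.cong refl arg_cong2[where f = times] Cons.IH) auto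
  also have "\<dots> = golf_run p n (v # u # us @ vs) H X"
    using Cons.prems assms by (intro golf_run_swap) auto
  finally show ?case by simp
qed simp

text \<open>The first ball of \<open>vs\<close> is brought to the front of \<open>ws\<close> by
  adjacent swaps; the tails are then handled by induction.\<close>

lemma golf_run_perm:
  assumes "0 \<le> p" "p \<le> 1" "H \<subseteq> {0..<n}" "set vs \<subseteq> {0..<n}" "mset vs = mset ws"
  shows "golf_run p n vs H X = golf_run p n ws H X"
  using assms(3-5)
proof (induction vs arbitrary: ws H)
  case (Cons v vs)
  have "v \<in> set ws" using Cons.prems(3) by (metis list.set_intros(1) set_mset_mset)
  then obtain us us' where ws: "ws = us @ v # us'" by (auto simp: in_set_conv_decomp)
  have m: "mset vs = mset (us @ us')" using Cons.prems(3) ws by simp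
  have s: "set ws \<subseteq> {0..<n}" using Cons.prems(2,3) by (metis set_mset_mset)
  have "golf_run p n (v # vs) H X = golf_run p n (v # us @ us') H X"
    using Cons.prems m unfolding golf_run.simps by (intro sum.cong refl arg_cong2[where f = times] Cons.IH) auto
  also have "\<dots> = golf_run p n ws H X"
    unfolding ws by (rule golf_run_move_to_front[symmetric]) (use assms Cons.prems s ws in auto)
  finally show ?case .
qed simp

subsection \<open>Total mass\<close>

text \<open>Survival probability: the walk avoids \<open>H\<close> at the times
  \<open>0, ..., k - 1\<close>, so time \<open>k\<close> itself is not inspected.\<close>

fun unhit :: "real \<Rightarrow> nat \<Rightarrow> nat set \<Rightarrow> nat \<Rightarrow> nat \<Rightarrow> real" where
  "unhit p n H 0 v = 1"
| "unhit p n H (Suc k) v =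
     (if v \<in> H then 0
      else p * unhit p n H k ((v + 1) mod n) + (1 - p) * unhit p n H k ((v + n - 1) mod n))"

text \<open>Conservation of mass: before time \<open>k\<close> the walk has either been stopped at
  exactly one hole or has survived.\<close>

lemma sum_first_hit_plus_unhit:
  assumes "finite H"
  shows "(\<Sum>i<k. \<Sum>h\<in>H. first_hit p n H h i v) + unhit p n H k v = 1"
proof (induction k arbitrary: v)
  case (Suc k)
  show ?case
  proof (cases "v \<in> H")
    case True
    then show ?thesis using assms by (simp add: sum.lessThan_Suc_shift del: sum.lessThan_Suc)
  next
    case False
    define a b where "a = (v + 1) mod n" and "b = (v + n - 1) mod n"
    have "(\<Sum>h\<in>H. first_hit p n H h 0 v) = 0"
      using False by (intro sum.neutral) auto
    then have "(\<Sum>i<Suc k. \<Sum>h\<in>H. first_hit p n H h i v) =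
        p * (\<Sum>i<k. \<Sum>h\<in>H. first_hit p n H h i a) + (1 - p) * (\<Sum>i<k. \<Sum>h\<in>H. first_hit p n H h i b)"
      using False by (simp add: sum.lessThan_Suc_shift a_def b_def sum.distrib sum_distrib_left del: sum.lessThan_Suc)
    also have "\<dots> = p * (1 - unhit p n H k a) + (1 - p) * (1 - unhit p n H k b)"
      using Suc.IH[of a] Suc.IH[of b] by (metis add_diff_cancel_right')
    finally show ?thesis
      using False by (simp add: a_def b_def algebra_simps)
  qed
qed auto

lemma unhit_nonneg: "0 \<le> p \<Longrightarrow> p \<le> 1 \<Longrightarrow> 0 \<le> unhit p n H k v"
  by (induction k arbitrary: v) auto

lemma unhit_Suc_le:
  assumes "0 \<le> p" "p \<le> 1"
  shows "unhit p n H (Suc k) v \<le> unhit p n H k v"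
proof (induction k arbitrary: v)
  case (Suc k)
  show ?case
    unfolding unhit.simps(2)[of p n H "Suc k" v] unhit.simps(2)[of p n H k v]
    using assms Suc.IH by (auto intro!: add_mono mult_left_mono simp del: unhit.simps)
qed (use assms in auto)

lemma unhit_antimono:
  assumes "0 \<le> p" "p \<le> 1" "j \<le> k"
  shows "unhit p n H k v \<le> unhit p n H j v"
  using lift_Suc_antimono_le[of "\<lambda>k. unhit p n H k v", OF unhit_Suc_le[OF assms(1,2)] assms(3)] .

lemma unhit_le_1:
  assumes "0 \<le> p" "p \<le> 1"
  shows "unhit p n H k v \<le> 1"
  using unhit_antimono[OF assms, of 0 k] by simp

text \<open>The run of \<open>d\<close> consecutive right steps leads to a hole and has probability
  \<open>p ^ d\<close>. The index is \<open>Suc d\<close> because time \<open>d\<close> must be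
  inspected.\<close>

lemma unhit_Suc_le_right:
  assumes "0 \<le> p" "p \<le> 1" "(v + d) mod n \<in> H" "v < n"
  shows "unhit p n H (Suc d) v \<le> 1 - p ^ d"
  using assms(3,4)
proof (induction d arbitrary: v)
  case 0
  then show ?case by simp
next
  case (Suc d)
  have "((v + 1) mod n + d) mod n \<in> H"
    using Suc.prems by (simp add: mod_add_left_eq)
  then have "unhit p n H (Suc d) ((v + 1) mod n) \<le> 1 - p ^ d"
    using Suc.prems by (intro Suc.IH) auto
  then have "p * unhit p n H (Suc d) ((v + 1) mod n) + (1 - p) * unhit p n H (Suc d) ((v + n - 1) mod n)
      \<le> p * (1 - p ^ d) + (1 - p) * 1"
    using assms by (intro add_mono mult_left_mono unhit_le_1) auto
  also have "\<dots> = 1 - p ^ Suc d" by (simp add: algebra_simps)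
  finally show ?case
    unfolding unhit.simps(2)[of p n H "Suc d" v]
    using assms by (simp add: power_le_one del: unhit.simps power_Suc)
qed

lemma unhit_Suc_le_left:
  assumes "0 \<le> p" "p \<le> 1" "(v + n - d) mod n \<in> H" "v < n" "d \<le> n"
  shows "unhit p n H (Suc d) v \<le> 1 - (1 - p) ^ d"
  using assms(3-5)
proof (induction d arbitrary: v)
  case 0
  then show ?case by simp
next
  case (Suc d)
  have "((v + n - 1) mod n + n - d) mod n = ((v + n - 1) mod n + (n - d)) mod n"
    using Suc.prems by simp
  also have "\<dots> = (v + n - 1 + (n - d)) mod n"
    by (rule mod_add_left_eq)
  also have "v + n - 1 + (n - d) = (v + n - Suc d) + n"
    using Suc.prems by simp
  also have "(v + n - Suc d + n) mod n = (v + n - Suc d) mod n"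
    by (rule mod_add_self2)
  finally have "((v + n - 1) mod n + n - d) mod n \<in> H"
    using Suc.prems by (simp only:)
  then have "unhit p n H (Suc d) ((v + n - 1) mod n) \<le> 1 - (1 - p) ^ d"
    using Suc.prems by (intro Suc.IH) auto
  then have "p * unhit p n H (Suc d) ((v + 1) mod n) + (1 - p) * unhit p n H (Suc d) ((v + n - 1) mod n)
      \<le> p * 1 + (1 - p) * (1 - (1 - p) ^ d)"
    using assms by (intro add_mono mult_left_mono unhit_le_1) auto
  also have "\<dots> = 1 - (1 - p) ^ Suc d" by (simp add: algebra_simps)
  finally show ?case
    unfolding unhit.simps(2)[of p n H "Suc d" v]
    using assms by (simp add: power_le_one del: unhit.simps power_Suc)
qed

text \<open>From any vertex a hole is reached in fewer than \<open>n\<close> steps by always moving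
  in the likelier direction. Taking the maximum of \<open>p\<close> and \<open>1 - p\<close> keeps
  the bound below 1 even for \<open>p = 0\<close> or \<open>p = 1\<close>.\<close>

lemma unhit_round_le:
  assumes p: "0 \<le> p" "p \<le> 1" and H: "H \<subseteq> {0..<n}" "H \<noteq> {}" and v: "v < n"
  shows "unhit p n H n v \<le> 1 - (max p (1 - p)) ^ n"
proof -
  obtain g where g: "g \<in> H" using H by blast
  then have gn: "g < n" using H by auto
  show ?thesis
  proof (cases "p \<ge> 1 - p")
    case True
    define d where "d = (if v \<le> g then g - v else g + n - v)"
    have "(v + d) mod n = g" and d: "Suc d \<le> n" using v gn by (auto simp: d_def)
    then have "unhit p n H n v \<le> 1 - p ^ d"
      using unhit_Suc_le_right[of p v d n H] unhit_antimono[OF p d, of n H v] p g v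
      by (simp del: unhit.simps)
    also have "\<dots> \<le> 1 - p ^ n"
      using d p by (simp add: power_decreasing)
    finally show ?thesis using True by (simp add: max_absorb1)
  next
    case False
    define d where "d = (if g \<le> v then v - g else v + n - g)"
    have "(v + n - d) mod n = g" and d: "Suc d \<le> n" using v gn by (auto simp: d_def)
    then have "unhit p n H n v \<le> 1 - (1 - p) ^ d"
      using unhit_Suc_le_left[of p v n d H] unhit_antimono[OF p d, of n H v] p g v
      by (simp del: unhit.simps)
    also have "\<dots> \<le> 1 - (1 - p) ^ n"
      using d p by (simp add: power_decreasing)
    finally show ?thesis using False by (simp add: max_absorb2)
  qed
qed

text \<open>Markov property at time \<open>a\<close>: after surviving \<open>a\<close> steps, the
  walk survives \<open>b\<close> more with probability at most \<open>c\<close>, wherever it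
  is.\<close>

lemma unhit_add_le:
  assumes "0 \<le> p" "p \<le> 1" "\<And>v. v < n \<Longrightarrow> unhit p n H b v \<le> c" "v < n"
  shows "unhit p n H (a + b) v \<le> c * unhit p n H a v"
  using assms(4)
proof (induction a arbitrary: v)
  case 0
  then show ?case using assms(3) by simp
next
  case (Suc a)
  have "p * unhit p n H (a + b) ((v + 1) mod n) + (1 - p) * unhit p n H (a + b) ((v + n - 1) mod n) \<le>
      p * (c * unhit p n H a ((v + 1) mod n)) + (1 - p) * (c * unhit p n H a ((v + n - 1) mod n))"
    using assms(1,2) Suc.prems by (intro add_mono mult_left_mono Suc.IH) auto
  then show ?case by (simp add: algebra_simps)
qed

text \<open>Rounds of \<open>n\<close> steps make the survival probability decay geometrically, so
  almost surely some hole is hit.\<close>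

lemma sum_hit_prob:
  assumes p: "0 \<le> p" "p \<le> 1" and H: "H \<subseteq> {0..<n}" "H \<noteq> {}" and v: "v < n"
  shows "(\<Sum>h\<in>H. hit_prob p n v H h) = 1"
proof -
  have fin: "finite H" using H finite_subset by blast
  define c where "c = 1 - (max p (1 - p)) ^ n"
  have c: "0 \<le> c" "c < 1" using p by (auto simp: c_def power_le_one)
  have geom: "unhit p n H (j * n) v \<le> c ^ j" for j
  proof (induction j)
    case (Suc j)
    have "unhit p n H (j * n + n) v \<le> c * unhit p n H (j * n) v"
      unfolding c_def by (rule unhit_add_le[OF p unhit_round_le[OF p H] v])
    also have "\<dots> \<le> c * c ^ j" using Suc c by (intro mult_left_mono) auto
    finally show ?case by (simp add: add.commute)
  qed simp
  have lim0: "(\<lambda>j. unhit p n H (j * n) v) \<longlonglongrightarrow> 0"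
  proof (rule tendsto_sandwich[OF _ _ tendsto_const LIMSEQ_realpow_zero[OF c]])
    show "\<forall>\<^sub>F j in sequentially. 0 \<le> unhit p n H (j * n) v"
      using unhit_nonneg[OF p] by simp
    show "\<forall>\<^sub>F j in sequentially. unhit p n H (j * n) v \<le> c ^ j"
      using geom by simp
  qed
  have "(\<lambda>k. \<Sum>h\<in>H. first_hit p n H h k v) sums (\<Sum>h\<in>H. hit_prob p n v H h)"
    unfolding hit_prob_eq_suminf[OF v]
    by (intro sums_sum summable_sums summable_first_hit p)
  then have "(\<lambda>k. \<Sum>i<k. \<Sum>h\<in>H. first_hit p n H h i v) \<longlonglongrightarrow> (\<Sum>h\<in>H. hit_prob p n v H h)"
    by (simp add: sums_def)
  moreover have "(\<Sum>i<k. \<Sum>h\<in>H. first_hit p n H h i v) = 1 - unhit p n H k v" for k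
    using sum_first_hit_plus_unhit[OF fin, where k = k and v = v] by (simp add: eq_diff_eq)
  ultimately have "(\<lambda>k. 1 - unhit p n H k v) \<longlonglongrightarrow> (\<Sum>h\<in>H. hit_prob p n v H h)"
    by simp
  \<comment> \<open>The decay is known only at multiples of \<open>n\<close>; since the limit
    already exists, it can be identified along this subsequence.\<close>
  then have "((\<lambda>k. 1 - unhit p n H k v) \<circ> (\<lambda>j. j * n)) \<longlonglongrightarrow> (\<Sum>h\<in>H. hit_prob p n v H h)"
    by (rule LIMSEQ_subseq_LIMSEQ) (use v in \<open>auto simp: strict_mono_def\<close>)
  then have "(\<lambda>j. 1 - unhit p n H (j * n) v) \<longlonglongrightarrow> (\<Sum>h\<in>H. hit_prob p n v H h)"
    by (simp add: comp_def)
  from tendsto_add[OF this lim0]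
  have "(\<lambda>j::nat. 1::real) \<longlonglongrightarrow> (\<Sum>h\<in>H. hit_prob p n v H h)" by simp
  then show ?thesis by (simp add: LIMSEQ_const_iff)
qed

text \<open>Each ball deletes exactly one hole and none is ever created. This is the criterion used
  below to discard terms of weight zero.\<close>

lemma golf_run_support:
  assumes "finite H" "golf_run p n vs H X \<noteq> 0"
  shows "X \<subseteq> H \<and> card H = length vs + card X"
  using assms
proof (induction vs arbitrary: H)
  case Nil
  then show ?case by (auto split: if_splits)
next
  case (Cons v vs)
  then obtain h where h: "h \<in> H" "golf_run p n vs (H - {h}) X \<noteq> 0"
    by (auto elim: sum.not_neutral_contains_not_neutral)
  then have "X \<subseteq> H - {h} \<and> card (H - {h}) = length vs + card X"
    using Cons.IH[of "H - {h}"] Cons.prems(1) by simp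
  then show ?case using h Cons.prems(1) card_Suc_Diff1[of H h] by auto
qed

text \<open>Having at least as many holes as balls ensures that every ball finds a nonempty set of
  holes, so each step has total mass 1.\<close>

lemma sum_golf_run:
  assumes p: "0 \<le> p" "p \<le> 1" and "H \<subseteq> {0..<n}" "set vs \<subseteq> {0..<n}" "length vs \<le> card H"
  shows "(\<Sum>X\<in>Pow {0..<n}. golf_run p n vs H X) = 1"
  using assms(3-5)
proof (induction vs arbitrary: H)
  case Nil
  then show ?case by simp
next
  case (Cons v vs)
  have fin: "finite H" using Cons.prems finite_subset by blast
  have "(\<Sum>X\<in>Pow {0..<n}. golf_run p n (v # vs) H X) =
      (\<Sum>h\<in>H. hit_prob p n v H h * (\<Sum>X\<in>Pow {0..<n}. golf_run p n vs (H - {h}) X))"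
    by (simp add: sum_distrib_left) (rule sum.swap)
  also have "\<dots> = (\<Sum>h\<in>H. hit_prob p n v H h * 1)"
    using Cons.prems fin by (intro sum.cong refl arg_cong2[where f = times] Cons.IH) auto
  also have "\<dots> = 1"
    using sum_hit_prob[OF p, of H n v] Cons.prems by (cases "H = {}") auto
  finally show ?case .
qed

subsection \<open>Rotation invariance\<close>

lemma rotate_step:
  fixes y :: nat
  assumes "y < n"
  shows "((y + c) mod n + 1) mod n = ((y + 1) mod n + c) mod n"
    and "((y + c) mod n + n - 1) mod n = ((y + n - 1) mod n + c) mod n"
proof -
  show "((y + c) mod n + 1) mod n = ((y + 1) mod n + c) mod n"
    unfolding mod_add_left_eq by (simp add: ac_simps)
  have "((y + c) mod n + n - 1) mod n = ((y + c) mod n + (n - 1)) mod n"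
    using assms by simp
  also have "\<dots> = (y + c + (n - 1)) mod n" by (rule mod_add_left_eq)
  also have "y + c + (n - 1) = y + n - 1 + c" using assms by simp
  finally show "((y + c) mod n + n - 1) mod n = ((y + n - 1) mod n + c) mod n"
    unfolding mod_add_left_eq .
qed

lemma inj_on_rotate: "inj_on (\<lambda>y. (y + c) mod n) {0..<n::nat}"
\<comment> \<open>The inverse rotation adds \<open>n - c mod n\<close>, which is correct for every
  \<open>c\<close>, including \<open>c\<close> larger than \<open>n\<close>.\<close>
proof (rule inj_on_inverseI[where g = "\<lambda>z. (z + (n - c mod n)) mod n"])
  fix y assume "y \<in> {0..<n}"
  then have "y < n" "c mod n < n" by auto
  then have "y + c + (n - c mod n) = y + n * (c div n + 1)"
    using mult_div_mod_eq[of n c] by (simp only: distrib_left)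
  then show "((y + c) mod n + (n - c mod n)) mod n = y"
    using \<open>y < n\<close> unfolding mod_add_left_eq by (simp only: mod_mult_self2 mod_less)
qed

text \<open>The coupling principle summed over time. It serves both for rotations of one cycle and
  for comparing a block with its own smaller cycle.\<close>

lemma hit_prob_simulation:
  assumes "y < m" "z < n" "R y z"
    and "\<And>y z. R y z \<Longrightarrow> (y = h' \<longleftrightarrow> z = h) \<and> (y \<in> H' \<longleftrightarrow> z \<in> H)"
    and "\<And>y z. R y z \<Longrightarrow> y \<notin> H' \<Longrightarrow>
      R ((y + 1) mod m) ((z + 1) mod n) \<and> R ((y + m - 1) mod m) ((z + n - 1) mod n)"
  shows "hit_prob p m y H' h' = hit_prob p n z H h"
  using first_hit_simulation[of R, OF assms(3-5)]
  by (simp add: hit_prob_eq_suminf assms(1,2))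

lemma hit_prob_rotate:
  assumes "H \<subseteq> {0..<n}" "v < n" "h < n"
  shows "hit_prob p n ((v + c) mod n) ((\<lambda>y. (y + c) mod n) ` H) ((h + c) mod n) = hit_prob p n v H h"
proof (rule hit_prob_simulation[symmetric, where R = "\<lambda>y z. y < n \<and> z = (y + c) mod n"], goal_cases)
  case (4 y z)
  have "(y + c) mod n = (h + c) mod n \<longleftrightarrow> y = h"
    using inj_on_eq_iff[OF inj_on_rotate[of c n], of y h] 4 assms by auto
  moreover have "(y + c) mod n \<in> (\<lambda>y. (y + c) mod n) ` H \<longleftrightarrow> y \<in> H"
    using inj_on_image_mem_iff[OF inj_on_rotate[of c n], of y H] 4 assms by auto
  ultimately show ?case using 4 by simp
next
  case (5 y z)
  then show ?case using rotate_step[of y n c] assms(2) by auto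
qed (use assms in auto)

lemma golf_run_rotate:
  assumes "H \<subseteq> {0..<n}" "set vs \<subseteq> {0..<n}" "X \<subseteq> {0..<n}"
  shows "golf_run p n (map (\<lambda>y. (y + c) mod n) vs) ((\<lambda>y. (y + c) mod n) ` H) ((\<lambda>y. (y + c) mod n) ` X)
    = golf_run p n vs H X"
  using assms(1,2)
proof (induction vs arbitrary: H)
  case Nil
  then show ?case using inj_on_image_eq_iff[OF inj_on_rotate[of c n], of H X] assms by simp
next
  case (Cons v vs)
  let ?r = "\<lambda>y. (y + c) mod n"
  have inj: "inj_on ?r H" using inj_on_subset[OF inj_on_rotate] Cons.prems by blast
  have IH: "golf_run p n (map ?r vs) (?r ` (H - {h})) (?r ` X) = golf_run p n vs (H - {h}) X" for h
    using Cons.prems by (intro Cons.IH) auto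
  have "?r ` H - {?r h} = ?r ` (H - {h})" if "h \<in> H" for h
    using inj_on_image_set_diff[OF inj, of H "{h}"] that by simp
  then show ?case
    using Cons.prems
    unfolding list.map golf_run.simps sum.reindex[OF inj] comp_def
    by (intro sum.cong refl arg_cong2[where f = times] hit_prob_rotate) (auto simp: IH)
qed

section \<open>Eliminating the clocks and counting configurations\<close>

text \<open>The unnormalised law, with the balls played in increasing order of position; by order
  invariance this order is as good as any other.\<close>

definition config_sum :: "real \<Rightarrow> nat \<Rightarrow> nat \<Rightarrow> nat \<Rightarrow> nat set \<Rightarrow> real" where
  "config_sum p n Nb Nh X =
     (\<Sum>(B, H)\<in>golf_configs n Nb Nh. golf_run p n (sorted_list_of_set B) H X)"

lemma golf_run_sorted_list_of_set:
  assumes "0 \<le> p" "p \<le> 1" "H \<subseteq> {0..<n}" "set vs \<subseteq> {0..<n}" "distinct vs"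
  shows "golf_run p n (sorted_list_of_set (set vs)) H X = golf_run p n vs H X"
  by (rule golf_run_perm) (use assms in \<open>auto simp: set_eq_iff_mset_eq_distinct[symmetric]\<close>)

lemma finite_golf_configs: "finite (golf_configs n Nb Nh)"
  by (rule finite_subset[of _ "Pow {0..<n} \<times> Pow {0..<n}"]) (auto simp: golf_configs_def)

text \<open>By order invariance the integrand is constant in the clocks, and the clock measure has
  total mass 1.\<close>

lemma golf_prob_eq_config_sum:
  assumes "0 \<le> p" "p \<le> 1"
  shows "golf_prob n Nb Nh p X = config_sum p n Nb Nh X / real (card (golf_configs n Nb Nh))"
proof -
  interpret prob_space "clock_measure n"
    unfolding clock_measure_def by (intro prob_space_PiM prob_space_uniform_measure) auto
  have "golf_run p n (sort_key C (sorted_list_of_set B)) H X = golf_run p n (sorted_list_of_set B) H X"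
    if "(B, H) \<in> golf_configs n Nb Nh" for B H and C :: "nat \<Rightarrow> real"
    using that finite_subset[of B "{0..<n}"]
    by (intro golf_run_perm assms) (auto simp: golf_configs_def)
  then show ?thesis
    by (auto simp: golf_prob_def config_sum_def prob_space intro!: sum.cong)
qed

lemma card_golf_configs:
  assumes "Nb + Nh \<le> n"
  shows "real (card (golf_configs n Nb Nh)) = fact n / (fact Nb * fact Nh * fact (n - Nb - Nh))"
proof -
  \<comment> \<open>The holes are chosen first, then the balls among the remaining vertices.\<close>
  have "golf_configs n Nb Nh = (\<lambda>(H, B). (B, H)) `
    (SIGMA H:{H. H \<subseteq> {0..<n} \<and> card H = Nh}. {B. B \<subseteq> {0..<n} - H \<and> card B = Nb})"
    by (auto simp: golf_configs_def image_iff)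
  then have "card (golf_configs n Nb Nh) =
      card (SIGMA H:{H. H \<subseteq> {0..<n} \<and> card H = Nh}. {B. B \<subseteq> {0..<n} - H \<and> card B = Nb})"
    by (simp add: card_image inj_on_def case_prod_unfold prod_eq_iff)
  also have "\<dots> = (\<Sum>H\<in>{H. H \<subseteq> {0..<n} \<and> card H = Nh}. card {B. B \<subseteq> {0..<n} - H \<and> card B = Nb})"
    by (rule card_SigmaI) auto
  also have "\<dots> = (\<Sum>H\<in>{H. H \<subseteq> {0..<n} \<and> card H = Nh}. (n - Nh) choose Nb)"
    by (intro sum.cong refl) (auto simp: n_subsets card_Diff_subset finite_subset[of _ "{0..<n}"])
  also have "\<dots> = (n choose Nh) * ((n - Nh) choose Nb)"
    by (simp add: n_subsets)
  finally show ?thesis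
    using assms by (simp add: binomial_fact add.commute)
qed

text \<open>Rotation by \<open>c\<close> permutes the configurations, with inverse the rotation by
  \<open>n - c\<close>, and it preserves the weight of each.\<close>

lemma config_sum_rotate:
  assumes "0 \<le> p" "p \<le> 1" "X \<subseteq> {0..<n}" "c < n"
  shows "config_sum p n Nb Nh ((\<lambda>y. (y + c) mod n) ` X) = config_sum p n Nb Nh X"
proof -
  define r where "r = (\<lambda>c y::nat. (y + c) mod n)"
  have inv: "r (n - c) (r c y) = y" "r c (r (n - c) y) = y" if "y < n" for y
    using that assms(4) unfolding r_def mod_add_left_eq by (simp_all add: add.assoc)
  have invS: "r (n - c) ` r c ` S = S" "r c ` r (n - c) ` S = S" if "S \<subseteq> {0..<n}" for S
  proof -
    have "(\<lambda>y. r (n - c) (r c y)) ` S = (\<lambda>y. y) ` S" "(\<lambda>y. r c (r (n - c) y)) ` S = (\<lambda>y. y) ` S"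
      by (rule image_cong; use that inv in auto)+
    then show "r (n - c) ` r c ` S = S" "r c ` r (n - c) ` S = S" by (simp_all add: image_image)
  qed
  have rc: "(r d ` B, r d ` H) \<in> golf_configs n Nb Nh" if "(B, H) \<in> golf_configs n Nb Nh" for B H d
  proof -
    have BH: "B \<subseteq> {0..<n}" "H \<subseteq> {0..<n}" "B \<inter> H = {}" "card B = Nb" "card H = Nh"
      using that by (auto simp: golf_configs_def)
    have "inj_on (r d) {0..<n}" unfolding r_def by (rule inj_on_rotate)
    then have "r d ` B \<inter> r d ` H = {}" "card (r d ` B) = Nb" "card (r d ` H) = Nh"
      using BH inj_on_image_Int[of "r d" "{0..<n}" B H] card_image[OF inj_on_subset[of "r d" "{0..<n}"]]
      by simp_all
    then show ?thesis using assms(4) by (auto simp: golf_configs_def r_def)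
  qed
  have run: "golf_run p n (sorted_list_of_set (r c ` B)) (r c ` H) (r c ` X) =
      golf_run p n (sorted_list_of_set B) H X" if "(B, H) \<in> golf_configs n Nb Nh" for B H
  proof -
    have BH: "B \<subseteq> {0..<n}" "H \<subseteq> {0..<n}" "finite B"
      using that finite_subset[of B "{0..<n}"] by (auto simp: golf_configs_def)
    have "inj_on (r c) B" using inj_on_subset[OF inj_on_rotate BH(1)] unfolding r_def .
    \<comment> \<open>The rotated list of balls need not be sorted, so order invariance is needed
      before rotating back.\<close>
    then have "golf_run p n (sorted_list_of_set (set (map (r c) (sorted_list_of_set B)))) (r c ` H) (r c ` X)
        = golf_run p n (map (r c) (sorted_list_of_set B)) (r c ` H) (r c ` X)"
      using BH assms by (intro golf_run_sorted_list_of_set) (auto simp: r_def distinct_map)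
    also have "\<dots> = golf_run p n (sorted_list_of_set B) H X"
      unfolding r_def using BH assms by (intro golf_run_rotate) auto
    finally show ?thesis using BH by simp
  qed
  define rot where "rot = (\<lambda>d (B, H). (r d ` B, r d ` H))"
  have rot: "rot (n - c) (rot c q) = q" "rot c (rot (n - c) q) = q" "rot d q \<in> golf_configs n Nb Nh"
    if "q \<in> golf_configs n Nb Nh" for q d
  proof -
    obtain B H where q: "q = (B, H)" by (cases q)
    then have "B \<subseteq> {0..<n}" "H \<subseteq> {0..<n}" using that by (auto simp: golf_configs_def)
    then show "rot (n - c) (rot c q) = q" "rot c (rot (n - c) q) = q" "rot d q \<in> golf_configs n Nb Nh"
      using invS[of B] invS[of H] rc[of B H d] that unfolding q rot_def prod.case by (simp_all only:)
  qed
  have "config_sum p n Nb Nh X = config_sum p n Nb Nh (r c ` X)"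
    unfolding config_sum_def
    by (rule sum.reindex_bij_witness[where i = "rot (n - c)" and j = "rot c"])
       (simp_all only: rot, auto simp: rot_def run)
  then show ?thesis by (simp add: r_def)
qed

section \<open>A cycle with exactly one surplus hole\<close>

text \<open>Summing over the position of the free hole gives \<open>m\<close> equal terms, and their
  total is the number of configurations because each configuration contributes mass 1.\<close>

lemma config_sum_single_free_hole:
  assumes p: "0 \<le> p" "p \<le> 1" and b: "2 * b < m"
  shows "config_sum p m b (b + 1) {0} = fact (m - 1) / (fact b * fact (b + 1) * fact (m - 1 - 2 * b))"
proof -
  have one: "(\<Sum>x\<in>{0..<m}. golf_run p m (sorted_list_of_set B) H {x}) = 1"
    if "(B, H) \<in> golf_configs m b (b + 1)" for B H
  proof -
    have BH: "B \<subseteq> {0..<m}" "H \<subseteq> {0..<m}" "finite B" "finite H" "card B = b" "card H = b + 1"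
      using that finite_subset[of B "{0..<m}"] finite_subset[of H "{0..<m}"]
      by (auto simp: golf_configs_def)
    have "(\<Sum>x\<in>{0..<m}. golf_run p m (sorted_list_of_set B) H {x}) =
        (\<Sum>X\<in>(\<lambda>x. {x}) ` {0..<m}. golf_run p m (sorted_list_of_set B) H X)"
      by (simp add: sum.reindex)
    \<comment> \<open>With \<open>b\<close> balls and \<open>b + 1\<close> holes, only singletons
      can be final sets of positive weight.\<close>
    also have "\<dots> = (\<Sum>X\<in>Pow {0..<m}. golf_run p m (sorted_list_of_set B) H X)"
    proof (rule sum.mono_neutral_left)
      show "\<forall>X\<in>Pow {0..<m} - (\<lambda>x. {x}) ` {0..<m}. golf_run p m (sorted_list_of_set B) H X = 0"
      proof (rule ballI, rule ccontr)
        fix X assume X: "X \<in> Pow {0..<m} - (\<lambda>x. {x}) ` {0..<m}"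
          and "golf_run p m (sorted_list_of_set B) H X \<noteq> 0"
        then have "card H = length (sorted_list_of_set B) + card X"
          using golf_run_support[OF BH(4)] by blast
        then have "card X = 1" using BH by simp
        then show False using X by (auto simp: card_1_singleton_iff)
      qed
    qed auto
    also have "\<dots> = 1" using BH by (intro sum_golf_run p) auto
    finally show ?thesis .
  qed
  have rot: "config_sum p m b (b + 1) {x} = config_sum p m b (b + 1) {0}" if "x < m" for x
    using config_sum_rotate[OF p, of "{0}" m x b "b + 1"] that by simp
  have "(\<Sum>x\<in>{0..<m}. config_sum p m b (b + 1) {x}) = (\<Sum>x\<in>{0..<m}. config_sum p m b (b + 1) {0})"
    by (intro sum.cong refl rot) simp
  then have "real m * config_sum p m b (b + 1) {0} = (\<Sum>x\<in>{0..<m}. config_sum p m b (b + 1) {x})"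
    by simp
  also have "\<dots> = (\<Sum>(B, H)\<in>golf_configs m b (b + 1). \<Sum>x\<in>{0..<m}. golf_run p m (sorted_list_of_set B) H {x})"
    unfolding config_sum_def by (subst sum.swap) (simp add: case_prod_unfold)
  also have "\<dots> = (\<Sum>(B, H)\<in>golf_configs m b (b + 1). 1)"
    using one by (intro sum.cong refl) auto
  also have "\<dots> = fact m / (fact b * fact (b + 1) * fact (m - b - (b + 1)))"
    using card_golf_configs[of b "b + 1" m] b by simp
  also have "fact m = real m * fact (m - 1)" using b by (simp add: fact_reduce[of m])
  finally have "real m * config_sum p m b (b + 1) {0} =
      real m * (fact (m - 1) / (fact b * fact (b + 1) * fact (m - b - (b + 1))))"
    by simp
  then have "config_sum p m b (b + 1) {0} = fact (m - 1) / (fact b * fact (b + 1) * fact (m - b - (b + 1)))"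
    by (rule mult_left_cancel[THEN iffD1, rotated]) (use b in simp)
  moreover have "m - b - (b + 1) = m - 1 - 2 * b" by simp
  ultimately show ?thesis by (simp only:)
qed

subsection \<open>Decomposition into blocks\<close>

text \<open>The walk can leave \<open>S\<close> only from a vertex of \<open>H\<close>, and there it
  has already stopped.\<close>

lemma first_hit_eq_0:
  assumes "v \<in> S" "h \<notin> S"
    and "\<And>u. u \<in> S \<Longrightarrow> u \<notin> H \<Longrightarrow> (u + 1) mod n \<in> S \<and> (u + n - 1) mod n \<in> S"
  shows "first_hit p n H h k v = 0"
  using assms(1)
proof (induction k arbitrary: v)
  case (Suc k)
  then show ?case using assms(3)[OF Suc.prems] Suc.IH by simp
qed (use assms in auto)

text \<open>Block \<open>i\<close> consists of the hole \<open>x i\<close> followed by \<open>m i - 1\<close> vertices; it is unrolled onto a cycle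
  of length \<open>m i\<close> on which both holes bounding the block become the vertex \<open>0\<close>.\<close>

locale cycle_blocks =
  fixes n k :: nat and x m :: "nat \<Rightarrow> nat"
  assumes m_pos: "i < k \<Longrightarrow> 0 < m i"
    and x_less: "i < k \<Longrightarrow> x i < n"
    and x_next: "i < k \<Longrightarrow> (x i + m i) mod n \<in> x ` {..<k}"
    and bij: "bij_betw (\<lambda>(i, y). (x i + y) mod n) (SIGMA i:{..<k}. {0..<m i}) {0..<n}"
begin

text \<open>The coordinate \<open>y\<close> counts steps from the left hole of the block. The value
  \<open>y = m i\<close> is also used: it denotes the hole at the right end.\<close>

definition pos :: "nat \<Rightarrow> nat \<Rightarrow> nat" where
  "pos i y = (x i + y) mod n"

definition pull :: "nat \<Rightarrow> nat set \<Rightarrow> nat set" where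
  "pull i S = {y \<in> {0..<m i}. pos i y \<in> S}"

abbreviation X :: "nat set" where
  "X \<equiv> x ` {..<k}"

lemma pos_eq_iff:
  assumes "i < k" "j < k" "y < m i" "z < m j"
  shows "pos i y = pos j z \<longleftrightarrow> i = j \<and> y = z"
  using inj_on_eq_iff[OF bij_betw_imp_inj_on[OF bij], of "(i, y)" "(j, z)"] assms
  by (auto simp: pos_def)

lemma pos_less: "i < k \<Longrightarrow> pos i y < n"
  using x_less[of i] by (simp add: pos_def)

lemma pos_cases:
  assumes "v < n"
  obtains i y where "i < k" "y < m i" "v = pos i y"
proof -
  have "v \<in> (\<lambda>(i, y). (x i + y) mod n) ` (SIGMA i:{..<k}. {0..<m i})"
    using bij assms by (simp add: bij_betw_def)
  then show thesis using that by (auto simp: pos_def)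
qed

lemma pos_0: "i < k \<Longrightarrow> pos i 0 = x i"
  using x_less by (simp add: pos_def)

lemma pos_in_X_iff:
  assumes "i < k" "y < m i"
  shows "pos i y \<in> X \<longleftrightarrow> y = 0"
proof
  assume "pos i y \<in> X"
  then obtain j where "j < k" "pos i y = pos j 0" using pos_0 by auto
  then show "y = 0" using pos_eq_iff[of i j y 0] assms m_pos[of j] by simp
qed (use assms pos_0 in auto)

lemma pull_subset: "pull i S \<subseteq> {0..<m i}"
  by (auto simp: pull_def)

lemma finite_pull: "finite (pull i S)"
  using finite_subset[OF pull_subset] by blast

lemma zero_in_pull: "i < k \<Longrightarrow> X \<subseteq> S \<Longrightarrow> 0 \<in> pull i S"
  using m_pos[of i] by (auto simp: pull_def pos_0)

lemma pos_Suc: "(pos i y + 1) mod n = pos i (y + 1)"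
  unfolding pos_def mod_add_left_eq by simp

lemma pos_pred:
  assumes "0 < y" "0 < n"
  shows "(pos i y + n - 1) mod n = pos i (y - 1)"
proof -
  have "(pos i y + n - 1) mod n = ((x i + y) mod n + (n - 1)) mod n"
    using assms by (simp add: pos_def)
  also have "\<dots> = (x i + y + (n - 1)) mod n" by (rule mod_add_left_eq)
  also have "x i + y + (n - 1) = x i + (y - 1) + n" using assms by simp
  finally show ?thesis by (simp add: pos_def)
qed

text \<open>The walks on the large and the small cycle are coupled. Vertex \<open>0\<close> of the
  small cycle stands for either end of the block, whence the second alternative in \<open>R\<close>;
  both ends are holes, so the coupling need not continue from there.\<close>

lemma hit_prob_same_block:
  assumes i: "i < k" and H: "X \<subseteq> H" and y: "y < m i" and h: "0 < h" "h < m i"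
  shows "hit_prob p n (pos i y) H (pos i h) = hit_prob p (m i) y (pull i H) h"
proof (rule hit_prob_simulation[symmetric,
    where R = "\<lambda>y z. y < m i \<and> (z = pos i y \<or> y = 0 \<and> z = pos i (m i))"], goal_cases)
  case (4 y z)
  have "pos i (m i) \<in> X" using x_next[OF i] by (simp add: pos_def)
  moreover have "pos i h \<notin> X" using pos_in_X_iff[OF i] h by simp
  ultimately show ?case
    using 4 h H pos_eq_iff[OF i i, of y h] zero_in_pull[OF i H] by (auto simp: pull_def)
next
  case (5 y z)
  \<comment> \<open>The walk has not stopped, so it is strictly inside the block and the first
    alternative of \<open>R\<close> holds.\<close>
  then have y0: "0 < y" using zero_in_pull[OF i H] by (cases y) auto
  with 5 have z: "z = pos i y" by simp
  have ym: "y < m i" using 5(1) by (rule conjunct1)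
  have pred: "(y + m i - 1) mod m i = y - 1"
  proof -
    have "y + m i - 1 = y - 1 + m i" using y0 by simp
    moreover have "y - 1 < m i" using ym by linarith
    ultimately show ?thesis by (simp only: mod_add_self2 mod_less)
  qed
  have succ: "(y + 1) mod m i = (if y + 1 = m i then 0 else y + 1)"
    using ym by auto
  have n: "0 < n" using x_less[OF i] by simp
  show ?case
    unfolding z pos_Suc pos_pred[OF y0 n] pred
  \<comment> \<open>The small cycle wraps to \<open>0\<close> exactly when the large walk steps onto
    the right end \<open>pos i (m i)\<close>.\<close>
  proof (cases "y + 1 = m i")
    case True
    have "0 < m i" "y - 1 < m i" using ym by linarith+
    then show "((y + 1) mod m i < m i \<and> (pos i (y + 1) = pos i ((y + 1) mod m i) \<or>
        (y + 1) mod m i = 0 \<and> pos i (y + 1) = pos i (m i))) \<and>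
      (y - 1 < m i \<and> (pos i (y - 1) = pos i (y - 1) \<or> y - 1 = 0 \<and> pos i (y - 1) = pos i (m i)))"
      unfolding succ if_P[OF True] unfolding True by blast
  next
    case False
    have "y + 1 < m i" "y - 1 < m i" using False ym by linarith+
    then show "((y + 1) mod m i < m i \<and> (pos i (y + 1) = pos i ((y + 1) mod m i) \<or>
        (y + 1) mod m i = 0 \<and> pos i (y + 1) = pos i (m i))) \<and>
      (y - 1 < m i \<and> (pos i (y - 1) = pos i (y - 1) \<or> y - 1 = 0 \<and> pos i (y - 1) = pos i (m i)))"
      unfolding succ if_not_P[OF False] by blast
  qed
qed (use assms pos_less in auto)

text \<open>The set \<open>?S\<close>, which is the block with both its end holes, can be left only
  through those ends, where the walk stops.\<close>

lemma hit_prob_other_block: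
  assumes i: "i < k" and j: "j < k" "i \<noteq> j" and H: "X \<subseteq> H" and y: "y < m i" and h: "0 < h" "h < m j"
  shows "hit_prob p n (pos i y) H (pos j h) = 0"
proof -
  let ?S = "pos i ` {0..m i}"
  have n: "0 < n" using x_less[OF i] by simp
  have end_in: "pos i (m i) \<in> X" using x_next[OF i] by (simp add: pos_def)
  have "pos j h \<notin> ?S"
  proof
    assume "pos j h \<in> ?S"
    then obtain z where z: "z \<le> m i" "pos j h = pos i z" by auto
    show False
    proof (cases "z = m i")
      case True
      then show False using pos_in_X_iff[OF j(1) h(2)] h z end_in by simp
    next
      case False
      then show False using pos_eq_iff[OF j(1) i h(2), of z] z j by simp
    qed
  qed
  moreover have "(u + 1) mod n \<in> ?S \<and> (u + n - 1) mod n \<in> ?S" if u: "u \<in> ?S" "u \<notin> H" for u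
  proof -
    obtain z where z: "z \<le> m i" "u = pos i z" using u by auto
    have "pos i 0 \<in> H" using H pos_0[OF i] i by auto
    then have "z \<noteq> m i" "z \<noteq> 0" using u z end_in H by auto
    then show ?thesis using z pos_Suc[of i z] pos_pred[of z i] n by auto
  qed
  ultimately have "first_hit p n H (pos j h) t (pos i y) = 0" for t
    using y by (intro first_hit_eq_0[where S = ?S]) auto
  then show ?thesis by (simp add: hit_prob_eq_suminf[OF pos_less[OF i]])
qed

lemma pull_remove:
  assumes "i < k" "j < k" "h < m j"
  shows "pull i (H - {pos j h}) = (if i = j then pull j H - {h} else pull i H)"
  using assms by (auto simp: pull_def pos_eq_iff)

lemma eq_X_iff_pull:
  assumes "X \<subseteq> H" "H \<subseteq> {0..<n}"
  shows "H = X \<longleftrightarrow> (\<forall>i<k. pull i H = {0})"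
proof
  assume "H = X"
  then show "\<forall>i<k. pull i H = {0}" using pos_in_X_iff m_pos by (auto simp: pull_def)
next
  assume *: "\<forall>i<k. pull i H = {0}"
  have "v \<in> X" if "v \<in> H" for v
  proof -
    have "v < n" using that assms by auto
    then obtain i y where iy: "i < k" "y < m i" "v = pos i y" by (rule pos_cases)
    then have "y \<in> pull i H" using that by (simp add: pull_def)
    then show ?thesis using * iy pos_in_X_iff by auto
  qed
  then show "H = X" using assms by blast
qed

section \<open>Factorisation of the weight over the blocks\<close>

text \<open>Balls are listed as pairs of block and coordinate. Playing one ball changes only the
  factor of its own block: filling a hole of \<open>X\<close> leaves weight zero, and holes strictly
  inside other blocks cannot be reached.\<close>

lemma golf_run_blocks:
  assumes "X \<subseteq> H" "H \<subseteq> {0..<n}" "set ws \<subseteq> (SIGMA i:{..<k}. {0..<m i})"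
  shows "golf_run p n (map (\<lambda>(i, y). pos i y) ws) H X =
    (\<Prod>i<k. golf_run p (m i) (map snd (filter (\<lambda>w. fst w = i) ws)) (pull i H) {0})"
  using assms
proof (induction ws arbitrary: H)
  case Nil
  show ?case
  proof (cases "\<forall>i<k. pull i H = {0}")
    case True
    then show ?thesis using eq_X_iff_pull[OF Nil(1,2)] by simp
  next
    case False
    then obtain i where "i < k" "pull i H \<noteq> {0}" by blast
    then have "(\<Prod>i<k. golf_run p (m i) [] (pull i H) {0}) = 0"
      by (intro prod_zero) auto
    then show ?thesis using False eq_X_iff_pull[OF Nil(1,2)] by simp
  qed
next
  case (Cons w ws)
  obtain j y where w: "w = (j, y)" by (cases w)
  have j: "j < k" "y < m j" using Cons.prems(3) w by auto
  have fin: "finite H" using Cons.prems(2) finite_subset by blast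
  define g where "g = (\<lambda>i S. golf_run p (m i) (map snd (filter (\<lambda>w. fst w = i) ws)) S {0})"
  define f where "f = (\<lambda>H. golf_run p n (map (\<lambda>(i, y). pos i y) ws) H X)"
  have inj: "inj_on (pos j) (pull j H - {0})"
    using pos_eq_iff[OF j(1) j(1)] by (auto simp: inj_on_def pull_def)
  have "golf_run p n (map (\<lambda>(i, y). pos i y) (w # ws)) H X =
      (\<Sum>h\<in>H. hit_prob p n (pos j y) H h * f (H - {h}))"
    by (simp add: w f_def)
  \<comment> \<open>Only holes strictly inside block \<open>j\<close> contribute: removing a hole of
    \<open>X\<close> makes the final set \<open>X\<close> impossible.\<close>
  also have "\<dots> = (\<Sum>h\<in>pos j ` (pull j H - {0}). hit_prob p n (pos j y) H h * f (H - {h}))"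
  proof (rule sum.mono_neutral_right[OF fin])
    show "\<forall>h\<in>H - pos j ` (pull j H - {0}). hit_prob p n (pos j y) H h * f (H - {h}) = 0"
    proof
      fix h assume h: "h \<in> H - pos j ` (pull j H - {0})"
      then have "h < n" using Cons.prems(2) by auto
      then obtain i z where iz: "i < k" "z < m i" "h = pos i z" by (rule pos_cases)
      consider "z = 0" | "z \<noteq> 0" "i \<noteq> j" using h iz by (auto simp: pull_def)
      then show "hit_prob p n (pos j y) H h * f (H - {h}) = 0"
      proof cases
        case 1
        then have "h \<in> X" using iz pos_in_X_iff by simp
        then have "f (H - {h}) = 0"
          using golf_run_support[of "H - {h}"] fin unfolding f_def by blast
        then show ?thesis by simp
      next
        case 2
        then show ?thesis using hit_prob_other_block[OF j(1) iz(1) _ Cons.prems(1) j(2)] iz by simp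
      qed
    qed
  qed (auto simp: pull_def)
  also have "\<dots> = (\<Sum>h\<in>pull j H - {0}. hit_prob p (m j) y (pull j H) h *
      (g j (pull j H - {h}) * (\<Prod>i\<in>{..<k} - {j}. g i (pull i H))))"
  proof (subst sum.reindex[OF inj], unfold comp_def, rule sum.cong[OF refl])
    fix h assume h: "h \<in> pull j H - {0}"
    then have hm: "h < m j" "pos j h \<notin> X" using pos_in_X_iff[OF j(1)] by (auto simp: pull_def)
    have "f (H - {pos j h}) = (\<Prod>i<k. g i (pull i (H - {pos j h})))"
      unfolding f_def g_def using Cons.prems hm by (intro Cons.IH) (blast, blast, simp)
    also have "\<dots> = g j (pull j (H - {pos j h})) * (\<Prod>i\<in>{..<k} - {j}. g i (pull i (H - {pos j h})))"
      using j by (intro prod.remove) auto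
    also have "\<dots> = g j (pull j H - {h}) * (\<Prod>i\<in>{..<k} - {j}. g i (pull i H))"
      using j hm pull_remove by (intro arg_cong2[where f = times] prod.cong) auto
    finally show "hit_prob p n (pos j y) H (pos j h) * f (H - {pos j h}) =
        hit_prob p (m j) y (pull j H) h * (g j (pull j H - {h}) * (\<Prod>i\<in>{..<k} - {j}. g i (pull i H)))"
      using hit_prob_same_block[OF j(1) Cons.prems(1) j(2)] h hm by simp
  qed
  also have "\<dots> = (\<Sum>h\<in>pull j H - {0}. hit_prob p (m j) y (pull j H) h * g j (pull j H - {h})) *
      (\<Prod>i\<in>{..<k} - {j}. g i (pull i H))"
    by (simp add: sum_distrib_right mult.assoc)
  \<comment> \<open>Coordinate \<open>0\<close> is put back to obtain a full step of
    \<open>golf_run\<close>; its term vanishes because \<open>0\<close> must stay free.\<close>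
  also have "(\<Sum>h\<in>pull j H - {0}. hit_prob p (m j) y (pull j H) h * g j (pull j H - {h})) =
      (\<Sum>h\<in>pull j H. hit_prob p (m j) y (pull j H) h * g j (pull j H - {h}))"
  proof (rule sum.mono_neutral_left[OF finite_pull])
    have "g j (pull j H - {0}) = 0"
      using golf_run_support[of "pull j H - {0}"] finite_pull unfolding g_def by blast
    then show "\<forall>h\<in>pull j H - (pull j H - {0}). hit_prob p (m j) y (pull j H) h * g j (pull j H - {h}) = 0"
      by auto
  qed auto
  also have "\<dots> = golf_run p (m j) (map snd (filter (\<lambda>w. fst w = j) ((j, y) # ws))) (pull j H) {0}"
    by (simp add: g_def)
  also have "(\<Prod>i\<in>{..<k} - {j}. g i (pull i H)) = (\<Prod>i\<in>{..<k} - {j}.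
      golf_run p (m i) (map snd (filter (\<lambda>w. fst w = i) ((j, y) # ws))) (pull i H) {0})"
    unfolding g_def by (intro prod.cong refl) simp
  finally show ?case
    unfolding w using j by (subst prod.remove[of _ j]) auto
qed

text \<open>Any enumeration of the balls by block and coordinate will do: order invariance is
  applied once on the whole cycle and once in each block.\<close>

lemma golf_run_sorted_blocks:
  assumes p: "0 \<le> p" "p \<le> 1" and H: "X \<subseteq> H" "H \<subseteq> {0..<n}" and B: "B \<subseteq> {0..<n}"
  shows "golf_run p n (sorted_list_of_set B) H X =
    (\<Prod>i<k. golf_run p (m i) (sorted_list_of_set (pull i B)) (pull i H) {0})"
proof -
  have "finite (SIGMA i:{..<k}. pull i B)" using finite_pull by blast
  then obtain ws where ws: "set ws = (SIGMA i:{..<k}. pull i B)" "distinct ws"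
    using finite_distinct_list by blast
  have sub: "set ws \<subseteq> (SIGMA i:{..<k}. {0..<m i})"
    using ws pull_subset by auto
  let ?vs = "map (\<lambda>(i, y). pos i y) ws"
  have "B \<subseteq> set ?vs"
  proof
    fix v assume v: "v \<in> B"
    then have "v < n" using B by auto
    then obtain i y where "i < k" "y < m i" "v = pos i y" by (rule pos_cases)
    then show "v \<in> set ?vs" using v ws by (force simp: pull_def)
  qed
  then have set_vs: "set ?vs = B" using ws by (auto simp: pull_def)
  have "distinct ?vs"
    unfolding distinct_map using ws sub pos_eq_iff by (auto simp: inj_on_def subset_eq)
  then have "golf_run p n (sorted_list_of_set B) H X = golf_run p n ?vs H X"
    using golf_run_sorted_list_of_set[OF p H(2), of ?vs] B set_vs by simp
  also have "\<dots> = (\<Prod>i<k. golf_run p (m i) (map snd (filter (\<lambda>w. fst w = i) ws)) (pull i H) {0})"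
    by (rule golf_run_blocks[OF H sub])
  also have "\<dots> = (\<Prod>i<k. golf_run p (m i) (sorted_list_of_set (pull i B)) (pull i H) {0})"
  proof (rule prod.cong[OF refl])
    fix i assume i: "i \<in> {..<k}"
    let ?us = "map snd (filter (\<lambda>w. fst w = i) ws)"
    have "set ?us = pull i B" using ws i by force
    moreover have "distinct ?us"
      using ws by (auto simp: distinct_map inj_on_def prod_eq_iff)
    ultimately show "golf_run p (m i) ?us (pull i H) {0} =
        golf_run p (m i) (sorted_list_of_set (pull i B)) (pull i H) {0}"
      using golf_run_sorted_list_of_set[OF p pull_subset[of i H], of ?us "{0}"] pull_subset[of i B] by simp
  qed
  finally show ?thesis .
qed

section \<open>Gluing block configurations\<close>

definition join :: "(nat \<Rightarrow> nat set) \<Rightarrow> nat set" where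
  "join S = (\<Union>i<k. pos i ` S i)"

lemma pull_join:
  assumes "i < k" "\<And>j. j < k \<Longrightarrow> S j \<subseteq> {0..<m j}"
  shows "pull i (join S) = S i"
proof
  show "pull i (join S) \<subseteq> S i"
  proof
    fix y assume "y \<in> pull i (join S)"
    then obtain j z where "y < m i" "j < k" "z \<in> S j" "pos i y = pos j z"
      by (auto simp: pull_def join_def)
    then show "y \<in> S i" using pos_eq_iff[of i j y z] assms by fastforce
  qed
  show "S i \<subseteq> pull i (join S)"
    using assms(1) assms(2)[OF assms(1)] by (auto simp: pull_def join_def)
qed

lemma join_pull:
  assumes "S \<subseteq> {0..<n}"
  shows "join (\<lambda>i. pull i S) = S"
proof
  show "S \<subseteq> join (\<lambda>i. pull i S)"
  proof
    fix v assume v: "v \<in> S"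
    then have "v < n" using assms by auto
    then obtain i y where "i < k" "y < m i" "v = pos i y" by (rule pos_cases)
    then show "v \<in> join (\<lambda>i. pull i S)" using v by (auto simp: pull_def join_def)
  qed
qed (auto simp: pull_def join_def)

lemma join_cong: "(\<And>i. i < k \<Longrightarrow> S i = T i) \<Longrightarrow> join S = join T"
  by (auto simp: join_def)

lemma join_subset: "join S \<subseteq> {0..<n}"
  using pos_less by (auto simp: join_def)

lemma card_eq_sum_pull:
  assumes "S \<subseteq> {0..<n}"
  shows "card S = (\<Sum>i<k. card (pull i S))"
proof -
  have "card (join (\<lambda>i. pull i S)) = (\<Sum>i<k. card (pos i ` pull i S))"
    unfolding join_def
    by (rule card_UN_disjoint) (use finite_pull pos_eq_iff in \<open>auto simp: pull_def\<close>)
  also have "\<dots> = (\<Sum>i<k. card (pull i S))"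
    by (intro sum.cong refl card_image) (use pos_eq_iff in \<open>auto simp: pull_def inj_on_def\<close>)
  finally show ?thesis using join_pull[OF assms] by simp
qed

text \<open>The condition on \<open>0\<close> reflects that the left end of the block is a hole from
  the start. The cardinalities are left free here and are imposed on whole families later.\<close>

definition local_configs :: "nat \<Rightarrow> (nat set \<times> nat set) set" where
  "local_configs i = {(B, H). B \<subseteq> {0..<m i} \<and> H \<subseteq> {0..<m i} \<and> B \<inter> H = {} \<and> 0 \<in> H}"

lemma finite_local_configs: "finite (local_configs i)"
  by (rule finite_subset[of _ "Pow {0..<m i} \<times> Pow {0..<m i}"]) (auto simp: local_configs_def)

text \<open>Restricting the function to \<open>{..<k}\<close> fixes its value outside, so that the
  results lie in an extensional product and gluing is a genuine inverse.\<close>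

definition restrict_blocks :: "nat set \<times> nat set \<Rightarrow> nat \<Rightarrow> nat set \<times> nat set" where
  "restrict_blocks = (\<lambda>(B, H). \<lambda>i\<in>{..<k}. (pull i B, pull i H))"

definition glue_blocks :: "(nat \<Rightarrow> nat set \<times> nat set) \<Rightarrow> nat set \<times> nat set" where
  "glue_blocks F = (join (\<lambda>i. fst (F i)), join (\<lambda>i. snd (F i)))"

lemma glue_restrict:
  assumes "B \<subseteq> {0..<n}" "H \<subseteq> {0..<n}"
  shows "glue_blocks (restrict_blocks (B, H)) = (B, H)"
proof -
  have "join (\<lambda>i. fst (restrict_blocks (B, H) i)) = join (\<lambda>i. pull i B)"
    "join (\<lambda>i. snd (restrict_blocks (B, H) i)) = join (\<lambda>i. pull i H)"
    by (rule join_cong; simp add: restrict_blocks_def)+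
  then show ?thesis using assms by (simp add: glue_blocks_def join_pull)
qed

lemma restrict_glue:
  assumes F: "F \<in> Pi\<^sub>E {..<k} local_configs"
  shows "restrict_blocks (glue_blocks F) = F"
proof
  fix i
  have sub: "fst (F j) \<subseteq> {0..<m j}" "snd (F j) \<subseteq> {0..<m j}" if "j < k" for j
    using PiE_mem[OF F, of j] that by (auto simp: local_configs_def)
  show "restrict_blocks (glue_blocks F) i = F i"
  proof (cases "i < k")
    case True
    have "pull i (join (\<lambda>i. fst (F i))) = fst (F i)" "pull i (join (\<lambda>i. snd (F i))) = snd (F i)"
      by (rule pull_join[OF True], rule sub, assumption)+
    then show ?thesis using True by (simp add: restrict_blocks_def glue_blocks_def)
  next
    case False
    then show ?thesis using PiE_arb[OF F, of i] by (simp add: restrict_blocks_def glue_blocks_def)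
  qed
qed

lemma restrict_blocks_in:
  assumes "X \<subseteq> H" "B \<inter> H = {}"
  shows "restrict_blocks (B, H) \<in> Pi\<^sub>E {..<k} local_configs"
  using assms zero_in_pull
  by (auto simp: restrict_blocks_def local_configs_def pull_def)

lemma glue_blocks_in:
  assumes F: "F \<in> Pi\<^sub>E {..<k} local_configs"
  shows "X \<subseteq> snd (glue_blocks F)" "fst (glue_blocks F) \<inter> snd (glue_blocks F) = {}"
proof -
  have loc: "F i \<in> local_configs i" if "i < k" for i
    using PiE_mem[OF F, of i] that by simp
  show "X \<subseteq> snd (glue_blocks F)"
  proof
    fix v assume "v \<in> X"
    then obtain i where "i < k" "v = pos i 0" using pos_0 by auto
    moreover from this have "0 \<in> snd (F i)" using loc[of i] by (auto simp: local_configs_def)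
    ultimately show "v \<in> snd (glue_blocks F)" by (auto simp: glue_blocks_def join_def)
  qed
  show "fst (glue_blocks F) \<inter> snd (glue_blocks F) = {}"
  proof (rule ccontr)
    assume "fst (glue_blocks F) \<inter> snd (glue_blocks F) \<noteq> {}"
    then obtain i j y z where iy: "i < k" "j < k" "y \<in> fst (F i)" "z \<in> snd (F j)" "pos i y = pos j z"
      by (auto simp: glue_blocks_def join_def)
    then have "y < m i" "z < m j"
      using loc[of i] loc[of j] by (auto simp: local_configs_def)
    then have "i = j" "y = z" using pos_eq_iff[of i j y z] iy by auto
    then show False using loc[of i] iy by (auto simp: local_configs_def)
  qed
qed

text \<open>Configurations whose holes contain \<open>X\<close> correspond bijectively to families
  of block configurations, and the weight factorises along this bijection.\<close>

lemma config_sum_eq_sum_families: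
  assumes p: "0 \<le> p" "p \<le> 1"
  shows "config_sum p n Nb (Nb + k) X =
    (\<Sum>F\<in>{F \<in> Pi\<^sub>E {..<k} local_configs. (\<Sum>i<k. card (fst (F i))) = Nb \<and>
          (\<forall>i<k. card (snd (F i)) = card (fst (F i)) + 1)}.
      \<Prod>i<k. golf_run p (m i) (sorted_list_of_set (fst (F i))) (snd (F i)) {0})"
    (is "_ = (\<Sum>F\<in>?T'. ?W F)")
proof -
  let ?S = "{(B, H) \<in> golf_configs n Nb (Nb + k). X \<subseteq> H}"
  let ?T = "{F \<in> Pi\<^sub>E {..<k} local_configs. (\<Sum>i<k. card (fst (F i))) = Nb \<and>
    (\<Sum>i<k. card (snd (F i))) = Nb + k}"
  have fin: "finite H" if "(B, H) \<in> golf_configs n Nb (Nb + k)" for B H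
    using that finite_subset[of H "{0..<n}"] by (auto simp: golf_configs_def)
  have card_glue: "card (fst (glue_blocks F)) = (\<Sum>i<k. card (fst (F i)))"
    "card (snd (glue_blocks F)) = (\<Sum>i<k. card (snd (F i)))"
    if F: "F \<in> Pi\<^sub>E {..<k} local_configs" for F
  proof -
    have "(pull i (fst (glue_blocks F)), pull i (snd (glue_blocks F))) = F i" if "i < k" for i
      using fun_cong[OF restrict_glue[OF F], of i] that
      by (simp add: restrict_blocks_def case_prod_unfold)
    then have "pull i (fst (glue_blocks F)) = fst (F i)" "pull i (snd (glue_blocks F)) = snd (F i)"
      if "i < k" for i
      using that by (metis fst_conv, metis snd_conv)
    moreover have "fst (glue_blocks F) \<subseteq> {0..<n}" "snd (glue_blocks F) \<subseteq> {0..<n}"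
      using join_subset by (simp_all add: glue_blocks_def)
    ultimately show "card (fst (glue_blocks F)) = (\<Sum>i<k. card (fst (F i)))"
      "card (snd (glue_blocks F)) = (\<Sum>i<k. card (snd (F i)))"
      by (simp_all add: card_eq_sum_pull)
  qed
  \<comment> \<open>A hole that is free at the end was a hole initially, so the other configurations
    have weight zero.\<close>
  have "config_sum p n Nb (Nb + k) X = (\<Sum>(B, H)\<in>?S. golf_run p n (sorted_list_of_set B) H X)"
    unfolding config_sum_def
  proof (rule sum.mono_neutral_right[OF finite_golf_configs])
    show "\<forall>q\<in>golf_configs n Nb (Nb + k) - ?S. (case q of (B, H) \<Rightarrow> golf_run p n (sorted_list_of_set B) H X) = 0"
    proof (rule ballI, rule ccontr)
      fix q assume q: "q \<in> golf_configs n Nb (Nb + k) - ?S"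
        and w: "(case q of (B, H) \<Rightarrow> golf_run p n (sorted_list_of_set B) H X) \<noteq> 0"
      obtain B H where BH: "q = (B, H)" by (cases q)
      then have "finite H" using q fin by blast
      then show False using golf_run_support[of H p n "sorted_list_of_set B" X] q w BH by simp
    qed
  qed auto
  also have "\<dots> = (\<Sum>F\<in>?T. ?W F)"
  proof (rule sum.reindex_bij_witness[where i = glue_blocks and j = restrict_blocks], goal_cases)
    case (1 q)
    then show ?case by (auto simp: golf_configs_def glue_restrict)
  next
    case (2 q)
    then obtain B H where q: "q = (B, H)" "(B, H) \<in> golf_configs n Nb (Nb + k)" "X \<subseteq> H" by auto
    then have "B \<subseteq> {0..<n}" "H \<subseteq> {0..<n}" "B \<inter> H = {}" "card B = Nb" "card H = Nb + k"
      by (auto simp: golf_configs_def)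
    then show ?case
      using restrict_blocks_in[of H B] q card_eq_sum_pull[of B] card_eq_sum_pull[of H]
      by (simp add: restrict_blocks_def)
  next
    case (3 F)
    then show ?case by (simp add: restrict_glue)
  next
    case (4 F)
    have "fst (glue_blocks F) \<subseteq> {0..<n}" "snd (glue_blocks F) \<subseteq> {0..<n}"
      using join_subset by (simp_all add: glue_blocks_def)
    then show ?case
      using 4 glue_blocks_in[of F] card_glue[of F] by (simp add: golf_configs_def case_prod_unfold)
  next
    case (5 q)
    then obtain B H where q: "q = (B, H)" "(B, H) \<in> golf_configs n Nb (Nb + k)" "X \<subseteq> H" by auto
    then show ?case
      using golf_run_sorted_blocks[OF p, of H B] by (simp add: golf_configs_def restrict_blocks_def)
  qed
  \<comment> \<open>The bijection fixes only the total number of holes. A block left with the single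
    hole \<open>0\<close> must have exactly one more hole than balls, so every other family has a
    vanishing factor.\<close>
  also have "\<dots> = (\<Sum>F\<in>?T'. ?W F)"
  proof (rule sum.mono_neutral_right)
    show "finite ?T"
      using finite_PiE[of "{..<k}" local_configs] finite_local_configs by simp
    show "?T' \<subseteq> ?T" by (auto simp: sum_Suc)
    show "\<forall>F\<in>?T - ?T'. ?W F = 0"
    proof
      fix F assume F: "F \<in> ?T - ?T'"
      then obtain i where i: "i < k" "card (snd (F i)) \<noteq> card (fst (F i)) + 1" by blast
      have "F i \<in> local_configs i" using F i PiE_mem[of F "{..<k}" local_configs i] by simp
      then have "finite (fst (F i))" "finite (snd (F i))"
        using finite_subset[of _ "{0..<m i}"] by (auto simp: local_configs_def)
      then have "golf_run p (m i) (sorted_list_of_set (fst (F i))) (snd (F i)) {0} = 0"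
        using golf_run_support[of "snd (F i)" p "m i" "sorted_list_of_set (fst (F i))" "{0}"] i by auto
      then show "?W F = 0" using i by (intro prod_zero) auto
    qed
  qed
  finally show ?thesis .
qed

section \<open>Summation over the numbers of balls per block\<close>

text \<open>The strict bound says that \<open>b i\<close> balls and \<open>b i + 1\<close> holes fit
  into \<open>m i\<close> vertices. The value 0 beyond \<open>k\<close> makes each tuple a unique
  function.\<close>

definition ball_counts :: "nat \<Rightarrow> (nat \<Rightarrow> nat) set" where
  "ball_counts Nb = {b. (\<forall>i\<ge>k. b i = 0) \<and> (\<Sum>i<k. b i) = Nb \<and> (\<forall>i<k. 2 * b i < m i)}"

lemma finite_ball_counts: "finite (ball_counts Nb)"
proof (rule finite_subset)
  show "ball_counts Nb \<subseteq> {f. \<forall>i. (i \<in> {..<k} \<longrightarrow> f i \<in> {..Nb}) \<and> (i \<notin> {..<k} \<longrightarrow> f i = 0)}"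
  proof (clarsimp simp: ball_counts_def)
    fix b :: "nat \<Rightarrow> nat" and i
    assume "i < k"
    then show "b i \<le> (\<Sum>i<k. b i)" by (intro member_le_sum) auto
  qed
  show "finite {f. \<forall>i. (i \<in> {..<k} \<longrightarrow> f i \<in> {..Nb}) \<and> (i \<notin> {..<k} \<longrightarrow> f i = (0::nat))}"
    by (rule finite_set_of_finite_funs) auto
qed

text \<open>For fixed numbers of balls the families form a full product of sets, so the sum of
  products becomes a product of sums.\<close>

lemma config_sum_blocks:
  assumes p: "0 \<le> p" "p \<le> 1"
  shows "config_sum p n Nb (Nb + k) X =
    (\<Sum>b\<in>ball_counts Nb. \<Prod>i<k. config_sum p (m i) (b i) (b i + 1) {0})"
proof -
  let ?w = "\<lambda>i (q::nat set \<times> nat set). golf_run p (m i) (sorted_list_of_set (fst q)) (snd q) {0}"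
  let ?T = "{F \<in> Pi\<^sub>E {..<k} local_configs. (\<Sum>i<k. card (fst (F i))) = Nb \<and>
    (\<forall>i<k. card (snd (F i)) = card (fst (F i)) + 1)}"
  let ?c = "\<lambda>F i. if i < k then card (fst (F i)) else 0"
  define L where "L = (\<lambda>i b. {q \<in> golf_configs (m i) b (b + 1). 0 \<in> snd q})"
  have L_iff: "q \<in> L i b \<longleftrightarrow> q \<in> local_configs i \<and> card (fst q) = b \<and> card (snd q) = b + 1" for q i b
    by (cases q) (auto simp: L_def local_configs_def golf_configs_def)
  have "finite ?T" using finite_PiE[of "{..<k}" local_configs] finite_local_configs by simp
  moreover have "?c ` ?T \<subseteq> ball_counts Nb"
  proof
    fix b assume "b \<in> ?c ` ?T"
    then obtain F where F: "F \<in> ?T" "b = ?c F" by blast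
    have "2 * card (fst (F i)) < m i" if i: "i < k" for i
    proof -
      have "F i \<in> local_configs i" using F i PiE_mem[of F "{..<k}" local_configs i] by simp
      then have "fst (F i) \<union> snd (F i) \<subseteq> {0..<m i}" "fst (F i) \<inter> snd (F i) = {}"
        by (auto simp: local_configs_def)
      then have "card (fst (F i)) + card (snd (F i)) \<le> m i"
        using card_mono[of "{0..<m i}" "fst (F i) \<union> snd (F i)"] finite_subset[of _ "{0..<m i}"]
        by (simp add: card_Un_disjoint)
      then show ?thesis using F i by simp
    qed
    then show "b \<in> ball_counts Nb" using F by (simp add: ball_counts_def)
  qed
  ultimately have "config_sum p n Nb (Nb + k) X =
      (\<Sum>b\<in>ball_counts Nb. \<Sum>F\<in>{F \<in> ?T. ?c F = b}. \<Prod>i<k. ?w i (F i))"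
    unfolding config_sum_eq_sum_families[OF p] by (intro sum.group[symmetric] finite_ball_counts)
  also have "\<dots> = (\<Sum>b\<in>ball_counts Nb. \<Sum>F\<in>Pi\<^sub>E {..<k} (\<lambda>i. L i (b i)). \<Prod>i<k. ?w i (F i))"
  proof (rule sum.cong[OF refl])
    fix b assume b: "b \<in> ball_counts Nb"
    have "{F \<in> ?T. ?c F = b} = Pi\<^sub>E {..<k} (\<lambda>i. L i (b i))"
    proof (intro set_eqI iffI)
      fix F assume F: "F \<in> {F \<in> ?T. ?c F = b}"
      then have PiE: "F \<in> Pi\<^sub>E {..<k} local_configs"
        and cards: "\<And>i. i < k \<Longrightarrow> card (snd (F i)) = card (fst (F i)) + 1" and b: "?c F = b"
        by blast+
      have "b i = card (fst (F i))" if "i < k" for i using fun_cong[OF b, of i] that by simp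
      then have "F i \<in> L i (b i)" if "i < k" for i
        using PiE_mem[OF PiE, of i] cards[of i] that by (simp add: L_iff)
      then show "F \<in> Pi\<^sub>E {..<k} (\<lambda>i. L i (b i))"
        using PiE_arb[OF PiE] by (intro PiE_I) simp_all
    next
      fix F assume F: "F \<in> Pi\<^sub>E {..<k} (\<lambda>i. L i (b i))"
      have Fi: "F i \<in> local_configs i \<and> card (fst (F i)) = b i \<and> card (snd (F i)) = b i + 1" if "i < k" for i
        using PiE_mem[OF F, of i] that by (simp add: L_iff)
      have "?c F i = b i" for i using Fi[of i] b by (simp add: ball_counts_def)
      then have "?c F = b" by (rule ext)
      moreover have "F \<in> Pi\<^sub>E {..<k} local_configs"
        using Fi PiE_arb[OF F] by (intro PiE_I) simp_all
      then have "F \<in> ?T" using Fi b by (simp add: ball_counts_def)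
      ultimately show "F \<in> {F \<in> ?T. ?c F = b}" by blast
    qed
    then show "(\<Sum>F\<in>{F \<in> ?T. ?c F = b}. \<Prod>i<k. ?w i (F i)) =
        (\<Sum>F\<in>Pi\<^sub>E {..<k} (\<lambda>i. L i (b i)). \<Prod>i<k. ?w i (F i))" by simp
  qed
  also have "\<dots> = (\<Sum>b\<in>ball_counts Nb. \<Prod>i<k. \<Sum>q\<in>L i (b i). ?w i q)"
    by (subst prod_sum_PiE) (auto simp: L_def finite_golf_configs)
  also have "\<dots> = (\<Sum>b\<in>ball_counts Nb. \<Prod>i<k. config_sum p (m i) (b i) (b i + 1) {0})"
  proof (intro sum.cong prod.cong refl)
    fix b i
    show "(\<Sum>q\<in>L i (b i). ?w i q) = config_sum p (m i) (b i) (b i + 1) {0}"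
      unfolding config_sum_def case_prod_unfold
    proof (rule sum.mono_neutral_left[OF finite_golf_configs])
      show "\<forall>q\<in>golf_configs (m i) (b i) (b i + 1) - L i (b i). ?w i q = 0"
      proof (rule ballI, rule ccontr)
        fix q assume q: "q \<in> golf_configs (m i) (b i) (b i + 1) - L i (b i)" and w: "?w i q \<noteq> 0"
        then have "finite (snd q)"
          using finite_subset[of "snd q" "{0..<m i}"] by (auto simp: golf_configs_def)
        from golf_run_support[OF this w] show False using q by (auto simp: L_def)
      qed
    qed (auto simp: L_def)
  qed
  finally show ?thesis .
qed

end

subsection \<open>The blocks of a set of free holes\<close>

text \<open>Each block is counted with its left hole, hence the \<open>+ 1\<close>. The lengths
  telescope to \<open>n\<close>, so it suffices to show that the blocks cover the cycle.\<close>

lemma cycle_blocks_sorted_list_of_set: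
  assumes X: "X \<subseteq> {0..<n}" "X \<noteq> {}"
  shows "cycle_blocks n (card X) (\<lambda>i. sorted_list_of_set X ! i) (\<lambda>i. block_size n X i + 1)"
proof -
  define k xs where "k = card X" and "xs = sorted_list_of_set X"
  have fin: "finite X" using X finite_subset by blast
  have k: "0 < k" using fin X by (simp add: k_def card_gt_0_iff)
  have len: "length xs = k" and set_xs: "set xs = X" and sorted: "sorted xs" "distinct xs"
    using fin by (simp_all add: xs_def k_def)
  have lt: "xs ! i < n" if "i < k" for i
    using nth_mem[of i xs] that len set_xs X by auto
  have mono: "xs ! i < xs ! j" if "i < j" "j < k" for i j
    using sorted_wrt_nth_less[of "(<)" xs i j] sorted that len by (simp add: strict_sorted_iff)
  have size_Suc: "block_size n X i + 1 = xs ! Suc i - xs ! i" if "Suc i < k" for i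
    using mono[of i "Suc i"] lt[OF that] that
    by (simp add: block_size_def Let_def k_def[symmetric] xs_def[symmetric])
  have first_le_last: "xs ! 0 \<le> xs ! (k - 1)"
    using mono[of 0 "k - 1"] k by (cases "k = 1") auto
  \<comment> \<open>The last block wraps around: the integer difference is negative, and adding
    \<open>n\<close> once brings it into range. This includes \<open>k = 1\<close>, where the block
    is the whole cycle minus its hole.\<close>
  have size_last: "block_size n X (k - 1) + 1 = n + xs ! 0 - xs ! (k - 1)"
  proof -
    have "(int (xs ! 0) - int (xs ! (k - 1)) - 1) mod int n =
        (int (xs ! 0) - int (xs ! (k - 1)) - 1 + int n) mod int n" by simp
    also have "\<dots> = int (xs ! 0) - int (xs ! (k - 1)) - 1 + int n"
      using first_le_last lt[of "k - 1"] lt[of 0] k by (intro mod_pos_pos_trivial) auto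
    finally show ?thesis
      using first_le_last lt[of "k - 1"] k
      by (simp add: block_size_def Let_def k_def[symmetric] xs_def[symmetric] nat_diff_distrib)
  qed
  have total: "(\<Sum>i<k. block_size n X i + 1) = n"
  proof -
    have "(\<Sum>i<j. block_size n X i + 1) = xs ! j - xs ! 0" if "j < k" for j
      using that
    proof (induction j)
      case (Suc j)
      moreover have "xs ! 0 \<le> xs ! j" using mono[of 0 j] Suc.prems by (cases "j = 0") auto
      ultimately show ?case using size_Suc[of j] mono[of j "Suc j"] by simp
    qed simp
    from this[of "k - 1"] have "(\<Sum>i<Suc (k - 1). block_size n X i + 1) =
        xs ! (k - 1) - xs ! 0 + (n + xs ! 0 - xs ! (k - 1))"
      unfolding sum.lessThan_Suc size_last using k by simp
    also have "\<dots> = n" using first_le_last lt[of "k - 1"] k by simp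
    finally show ?thesis using k by simp
  qed
  have end_pos: "(xs ! i + (block_size n X i + 1)) mod n = xs ! (Suc i mod k)" if "i < k" for i
  proof (cases "Suc i = k")
    case True
    then have "i = k - 1" by simp
    then show ?thesis using size_last lt[of i] lt[of 0] that by (simp add: True)
  next
    case False
    then have "Suc i < k" using that by simp
    then show ?thesis using size_Suc[of i] mono[of i "Suc i"] lt[of "Suc i"] by simp
  qed
  let ?f = "\<lambda>(i, y). (xs ! i + y) mod n" and ?D = "SIGMA i:{..<k}. {0..<block_size n X i + 1}"
  have img: "?f ` ?D = {0..<n}"
  proof
    show "?f ` ?D \<subseteq> {0..<n}" using lt by fastforce
    show "{0..<n} \<subseteq> ?f ` ?D"
    proof
      fix z assume z: "z \<in> {0..<n}"
      show "z \<in> ?f ` ?D"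
      proof (cases "z < xs ! 0")
        case True
        \<comment> \<open>A vertex before the first hole belongs to the wrapped part of the last
          block.\<close>
        have "z + n - xs ! (k - 1) < block_size n X (k - 1) + 1"
          "(xs ! (k - 1) + (z + n - xs ! (k - 1))) mod n = z"
          using size_last True lt[of "k - 1"] k z by auto
        then show ?thesis using k by (intro image_eqI[of _ _ "(k - 1, z + n - xs ! (k - 1))"]) auto
      next
        case False
        \<comment> \<open>The block containing \<open>z\<close> starts at the last hole not beyond
          \<open>z\<close>.\<close>
        define i where "i = Max {i. i < k \<and> xs ! i \<le> z}"
        have "i \<in> {i. i < k \<and> xs ! i \<le> z}"
          unfolding i_def using False k by (intro Max_in) auto
        then have i: "i < k" "xs ! i \<le> z" by auto
        have "z - xs ! i < block_size n X i + 1"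
        proof (cases "Suc i = k")
          case True
          then have "i = k - 1" by simp
          then have "xs ! (k - 1) \<le> z" using i by simp
          then show ?thesis
            using z unfolding \<open>i = k - 1\<close> size_last atLeastLessThan_iff by linarith
        next
          case ne: False
          have "Suc i \<notin> {i. i < k \<and> xs ! i \<le> z}"
          proof
            assume "Suc i \<in> {i. i < k \<and> xs ! i \<le> z}"
            then have "Suc i \<le> i" unfolding i_def by (intro Max_ge) auto
            then show False by simp
          qed
          then show ?thesis using size_Suc[of i] i ne by auto
        qed
        then show ?thesis using i z by (intro image_eqI[of _ _ "(i, z - xs ! i)"]) auto
      qed
    qed
  qed
  have "card ?D = n" using total by simp
  \<comment> \<open>A surjection between finite sets of equal size is injective.\<close>
  then have "inj_on ?f ?D" by (intro eq_card_imp_inj_on) (simp_all only: img, simp_all)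
  then have "bij_betw ?f ?D {0..<n}" using img by (simp add: bij_betw_def)
  moreover have "(xs ! i + (block_size n X i + 1)) mod n \<in> (!) xs ` {..<k}" if "i < k" for i
    unfolding end_pos[OF that] using k by (intro imageI) simp
  ultimately show ?thesis
    using lt unfolding k_def xs_def by unfold_locales auto
qed

theorem mainTheorem1:
  fixes n Nb Nh :: nat and p :: real and X :: "nat set"
  assumes "n \<ge> 1" and "Nb \<le> Nh" and "Nb + Nh \<le> n"
    and "0 \<le> p" and "p \<le> 1"
    and "X \<subseteq> {0..<n}" and "card X = Nh - Nb" and "Nh - Nb > 0"
  shows "golf_prob n Nb Nh p X =
    (1 / (fact n / (fact Nb * fact Nh * fact (n - Nb - Nh)))) *
    (\<Sum>b\<in>B_set n Nb X. \<Prod>i<card X.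
        (1 / real (b i + 1)) *
        (fact (block_size n X i) /
          (fact (b i) * fact (b i) * fact (block_size n X i - 2 * b i))))"
proof -
  have "X \<noteq> {}" using assms by auto
  then interpret cycle_blocks n "card X" "\<lambda>i. sorted_list_of_set X ! i" "\<lambda>i. block_size n X i + 1"
    using assms cycle_blocks_sorted_list_of_set by blast
  have fin: "finite X" using assms finite_subset by blast
  have X_eq: "(\<lambda>i. sorted_list_of_set X ! i) ` {..<card X} = X"
    using fin nth_image[of "card X" "sorted_list_of_set X"] by (simp add: atLeast0LessThan)
  have Nh: "Nh = Nb + card X" using assms by simp
  have counts: "ball_counts Nb = B_set n Nb X"
    unfolding ball_counts_def B_set_def by (simp add: less_Suc_eq_le)
  have "config_sum p n Nb Nh X =
      (\<Sum>b\<in>B_set n Nb X. \<Prod>i<card X. config_sum p (block_size n X i + 1) (b i) (b i + 1) {0})"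
    using config_sum_blocks[OF assms(4,5), of Nb] unfolding X_eq counts Nh .
  also have "\<dots> = (\<Sum>b\<in>B_set n Nb X. \<Prod>i<card X. (1 / real (b i + 1)) *
      (fact (block_size n X i) / (fact (b i) * fact (b i) * fact (block_size n X i - 2 * b i))))"
  proof (intro sum.cong prod.cong refl)
    fix b i assume "b \<in> B_set n Nb X" "i \<in> {..<card X}"
    then have "2 * b i < block_size n X i + 1" by (simp add: B_set_def less_Suc_eq_le)
    \<comment> \<open>The small cycle has one vertex more than the block, so \<open>m - 1\<close> is
      the block size; the factor \<open>1 / (b i + 1)\<close> comes from
      \<open>fact (b i + 1)\<close>.\<close>
    from config_sum_single_free_hole[OF assms(4,5) this]
    show "config_sum p (block_size n X i + 1) (b i) (b i + 1) {0} = (1 / real (b i + 1)) *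
        (fact (block_size n X i) / (fact (b i) * fact (b i) * fact (block_size n X i - 2 * b i)))"
      by (simp add: field_simps)
  qed
  finally show ?thesis
    using golf_prob_eq_config_sum[OF assms(4,5), of n Nb Nh X] card_golf_configs[OF assms(3)] by simp
qed

end
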